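(* Let $E$ be an infinite dimensional Banach space. Then the set of weak$^*$-null non-norm null sequences in $E^*$ is almost pointwise spaceable in $\ell_\infty(E^* )$. Furthermore, given a seminormalized weak$^*$-null $E^*$-valued sequence $\mathbf{x}^*$, there is a closed infinite dimensional subspace of $\ell_\infty(E^* )$ consisting, up to the origin, of weak$^*$-null non-norm null sequences and containing $\mathbf{x}^*$.
   Context: Banach spaces are real or complex; $E^*$ is the topological dual of $E$. $\ell_\infty(E^* )$ is the Banach space of bounded $E^*$-valued sequences with the supremum norm. A Banach sequence space is a linear subspace of $E^{\mathbb{N}}$, for some Banach space $E$, endowed with a complete norm. A nonempty subset $B$ of a Banach sequence space $X$ is almost pointwise spaceable (in $X$) if for every sequence $\mathbf{x} \in B$ there exists a closed infinite dimensional subspace of $X$ contained in $B \cup \{0\}$ and containing a subsequence of $\mathbf{x}$. A sequence $(x_j)_{j=1}^\infty$ is seminormalized if $0 < \inf_j \|x_j\| \leq \sup_j\|x_j\| < \infty$. *)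

theory Defs
  imports "HOL-Analysis.Analysis" "HOL-Library.Function_Algebras"
begin

section \<open>Normed spaces over the real or the complex field\<close>

text \<open>
  The library's normed spaces are real. A normed space over \<open>'k\<close> (used below with \<open>'k = real\<close> and
  \<open>'k = complex\<close>) is a type of class \<^class>\<open>real_normed_vector\<close> together with a homogeneous
  multiplication by scalars from \<open>'k\<close> that extends the multiplication by reals.
\<close>

locale normed_space_over = vector_space smul
  for smul :: "'k::real_normed_field \<Rightarrow> 'a::real_normed_vector \<Rightarrow> 'a" +
  assumes norm_scale: "norm (smul c x) = norm c * norm x"
    and scale_of_real: "smul (of_real r) x = r *\<^sub>R x"

lemma normed_space_over_scaleR:
  "normed_space_over (scaleR :: real \<Rightarrow> 'a::real_normed_vector \<Rightarrow> 'a)"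
  by unfold_locales (simp_all add: scaleR_right_distrib scaleR_left_distrib)

definition infinite_dimensional :: "('k::field \<Rightarrow> 'v::ab_group_add \<Rightarrow> 'v) \<Rightarrow> 'v set \<Rightarrow> bool" where
  "infinite_dimensional smul V \<longleftrightarrow> (\<nexists>S. finite S \<and> module.span smul S = V)"


section \<open>The dual space and its weak-star topology\<close>

text \<open>
  Elements of \<open>'a \<Rightarrow>\<^sub>L 'k\<close> are only real-linear; the dual consists of those that are
  \<open>'k\<close>-linear, with the operator norm of \<open>'a \<Rightarrow>\<^sub>L 'k\<close>.
\<close>

definition dual_space ::
    "('k::real_normed_field \<Rightarrow> 'a::real_normed_vector \<Rightarrow> 'a) \<Rightarrow> ('a \<Rightarrow>\<^sub>L 'k) set" where
  "dual_space smul = {f. \<forall>c v. blinfun_apply f (smul c v) = c * blinfun_apply f v}"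

definition dual_scale ::
    "'k::real_normed_field \<Rightarrow> ('a::real_normed_vector \<Rightarrow>\<^sub>L 'k) \<Rightarrow> ('a \<Rightarrow>\<^sub>L 'k)" where
  "dual_scale c f = blinfun_mult_right c o\<^sub>L f"

text \<open>
  For scalar-valued functionals, the strong operator topology is the topology of pointwise
  convergence.
\<close>

definition weak_star_topology ::
    "('k::real_normed_field \<Rightarrow> 'a::real_normed_vector \<Rightarrow> 'a) \<Rightarrow> ('a \<Rightarrow>\<^sub>L 'k) topology" where
  "weak_star_topology smul = subtopology strong_operator_topology (dual_space smul)"

definition weak_star_null ::
    "('k::real_normed_field \<Rightarrow> 'a::real_normed_vector \<Rightarrow> 'a) \<Rightarrow> (nat \<Rightarrow> 'a \<Rightarrow>\<^sub>L 'k) \<Rightarrow> bool" where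
  "weak_star_null smul x \<longleftrightarrow>
     range x \<subseteq> dual_space smul \<and> limitin (weak_star_topology smul) x 0 sequentially"

definition weak_star_null_non_norm_null ::
    "('k::real_normed_field \<Rightarrow> 'a::real_normed_vector \<Rightarrow> 'a) \<Rightarrow> (nat \<Rightarrow> 'a \<Rightarrow>\<^sub>L 'k) set" where
  "weak_star_null_non_norm_null smul = {x. weak_star_null smul x \<and> \<not> x \<longlonglongrightarrow> 0}"

definition seminormalized :: "(nat \<Rightarrow> 'f::real_normed_vector) \<Rightarrow> bool" where
  "seminormalized x \<longleftrightarrow> 0 < (INF j. norm (x j)) \<and> bdd_above (range (\<lambda>j. norm (x j)))"


section \<open>Banach sequence spaces\<close>

definition seq_scale :: "('k \<Rightarrow> 'f \<Rightarrow> 'f) \<Rightarrow> 'k \<Rightarrow> (nat \<Rightarrow> 'f) \<Rightarrow> (nat \<Rightarrow> 'f)" where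
  "seq_scale smul c x = (\<lambda>n. smul c (x n))"

text \<open>
  A set \<open>X\<close> of sequences with a norm \<open>N\<close>, of which only the values on \<open>X\<close> matter. As
  \<^locale>\<open>Metric_space\<close> demands a distance that is nonnegative and symmetric on the whole type,
  the distance is set to 0 outside \<open>X\<close>.
\<close>

definition norm_dist :: "(nat \<Rightarrow> 'f::ab_group_add) set \<Rightarrow> ((nat \<Rightarrow> 'f) \<Rightarrow> real)
    \<Rightarrow> (nat \<Rightarrow> 'f) \<Rightarrow> (nat \<Rightarrow> 'f) \<Rightarrow> real" where
  "norm_dist X N x y = (if x \<in> X \<and> y \<in> X then N (x - y) else 0)"

locale banach_sequence_space = normed_space_over smul
  for smul :: "'k::real_normed_field \<Rightarrow> 'f::banach \<Rightarrow> 'f" +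
  fixes X :: "(nat \<Rightarrow> 'f) set"
    and N :: "(nat \<Rightarrow> 'f) \<Rightarrow> real"
  assumes subspace_X: "module.subspace (seq_scale smul) X"
    and N_nonneg: "x \<in> X \<Longrightarrow> 0 \<le> N x"
    and N_eq_0_iff: "x \<in> X \<Longrightarrow> N x = 0 \<longleftrightarrow> x = 0"
    and N_triangle: "x \<in> X \<Longrightarrow> y \<in> X \<Longrightarrow> N (x + y) \<le> N x + N y"
    and N_scale: "x \<in> X \<Longrightarrow> N (seq_scale smul c x) = norm c * N x"
    and N_complete: "Metric_space.mcomplete X (norm_dist X N)"

definition closed_infinite_dimensional_subspace ::
    "('k::field \<Rightarrow> 'f::ab_group_add \<Rightarrow> 'f) \<Rightarrow> (nat \<Rightarrow> 'f) set \<Rightarrow> ((nat \<Rightarrow> 'f) \<Rightarrow> real)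
      \<Rightarrow> (nat \<Rightarrow> 'f) set \<Rightarrow> bool" where
  "closed_infinite_dimensional_subspace smul X N W \<longleftrightarrow>
     W \<subseteq> X \<and> module.subspace (seq_scale smul) W
     \<and> closedin (Metric_space.mtopology X (norm_dist X N)) W
     \<and> infinite_dimensional (seq_scale smul) W"

definition almost_pointwise_spaceable ::
    "('k::real_normed_field \<Rightarrow> 'f::banach \<Rightarrow> 'f) \<Rightarrow> (nat \<Rightarrow> 'f) set \<Rightarrow> ((nat \<Rightarrow> 'f) \<Rightarrow> real)
      \<Rightarrow> (nat \<Rightarrow> 'f) set \<Rightarrow> bool" where
  "almost_pointwise_spaceable smul X N B \<longleftrightarrow>
     banach_sequence_space smul X N \<and> B \<noteq> {} \<and> B \<subseteq> X
     \<and> (\<forall>x\<in>B. \<exists>W. closed_infinite_dimensional_subspace smul X N W \<and> W \<subseteq> B \<union> {0}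
             \<and> (\<exists>r::nat \<Rightarrow> nat. strict_mono r \<and> x \<circ> r \<in> W))"

definition linf :: "'f::real_normed_vector set \<Rightarrow> (nat \<Rightarrow> 'f) set" where
  "linf F = {x. range x \<subseteq> F \<and> bounded (range x)}"

definition sup_norm :: "(nat \<Rightarrow> 'f::real_normed_vector) \<Rightarrow> real" where
  "sup_norm x = (SUP n. norm (x n))"


section \<open>Basic facts\<close>

lemma dual_scale_apply [simp]: "blinfun_apply (dual_scale c f) v = c * blinfun_apply f v"
  by (simp add: dual_scale_def)

lemma dual_space_scaleR: "dual_space (scaleR :: real \<Rightarrow> 'a::real_normed_vector \<Rightarrow> 'a) = UNIV"
  by (auto simp: dual_space_def blinfun.scaleR_right)

lemma dual_scale_real: "dual_scale = (scaleR :: real \<Rightarrow> ('a::real_normed_vector \<Rightarrow>\<^sub>L real) \<Rightarrow> _)"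
  by (intro ext blinfun_eqI) (simp add: blinfun.scaleR_left)

lemma limitin_strong_operator_topology:
  "limitin strong_operator_topology x l F \<longleftrightarrow>
     (\<forall>v. ((\<lambda>n. blinfun_apply (x n) v) \<longlongrightarrow> blinfun_apply l v) F)"
proof -
  have "limitin strong_operator_topology x l F \<longleftrightarrow>
      limitin euclidean (\<lambda>n. blinfun_apply (x n)) (blinfun_apply l) F"
    unfolding limitin_def strong_operator_topology_def openin_pullback_topology
      topspace_pullback_topology
    by auto
  also have "\<dots> \<longleftrightarrow> (\<forall>v. ((\<lambda>n. blinfun_apply (x n) v) \<longlongrightarrow> blinfun_apply l v) F)"
    unfolding euclidean_product_topology[symmetric] by (simp add: limitin_componentwise)
  finally show ?thesis .
qed

lemma weak_star_null_iff:
  "weak_star_null smul x \<longleftrightarrow>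
     range x \<subseteq> dual_space smul \<and> (\<forall>v. (\<lambda>n. blinfun_apply (x n) v) \<longlonglongrightarrow> 0)"
proof -
  have "0 \<in> dual_space smul" by (simp add: dual_space_def)
  moreover have "\<forall>\<^sub>F n in sequentially. x n \<in> dual_space smul" if "range x \<subseteq> dual_space smul"
    using that by (intro always_eventually) blast
  ultimately show ?thesis
    by (auto simp: weak_star_null_def weak_star_topology_def limitin_subtopology
        limitin_strong_operator_topology)
qed

lemma vector_space_seq_scale:
  assumes "vector_space smul"
  shows "vector_space (seq_scale smul)"
proof -
  interpret vector_space smul by fact
  show ?thesis
    by unfold_locales
      (simp_all add: seq_scale_def fun_eq_iff scale_right_distrib scale_left_distrib)
qed

lemma norm_dual_scale: "norm (dual_scale c f) = norm c * norm f"
proof (cases "c = 0")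
  case True
  then have "dual_scale c f = 0" by (intro blinfun_eqI) simp
  then show ?thesis using True by simp
next
  case False
  have le: "norm (dual_scale d g) \<le> norm d * norm g" for d :: 'b and g :: "'a \<Rightarrow>\<^sub>L 'b"
  proof (rule norm_blinfun_bound)
    fix v
    show "norm (blinfun_apply (dual_scale d g) v) \<le> norm d * norm g * norm v"
      using norm_blinfun[of g v] by (simp add: norm_mult mult.assoc mult_left_mono)
  qed simp
  have "f = dual_scale (inverse c) (dual_scale c f)"
    using False by (intro blinfun_eqI) (simp add: mult.assoc[symmetric])
  then have "norm f \<le> norm (inverse c) * norm (dual_scale c f)"
    using le by metis
  then have "norm c * norm f \<le> norm (dual_scale c f)"
    using False by (simp add: norm_inverse pos_le_divide_eq mult.commute inverse_eq_divide norm_divide)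
  with le[of c f] show ?thesis by simp
qed

lemma normed_space_over_dual_scale:
  "normed_space_over (dual_scale :: 'k::real_normed_field \<Rightarrow> ('a::real_normed_vector \<Rightarrow>\<^sub>L 'k) \<Rightarrow> _)"
proof unfold_locales
  fix r :: real and f :: "'a \<Rightarrow>\<^sub>L 'k"
  show "dual_scale (of_real r) f = r *\<^sub>R f"
    by (intro blinfun_eqI) (simp add: blinfun.scaleR_left scaleR_conv_of_real)
qed (auto intro!: blinfun_eqI
      simp: norm_dual_scale blinfun.add_left distrib_left distrib_right)

lemma (in banach_sequence_space) Metric_space_norm_dist: "Metric_space X (norm_dist X N)"
proof -
  interpret S: vector_space "seq_scale smul"
    by (rule vector_space_seq_scale) unfold_locales
  note sub = subspace_X
  have minus: "seq_scale smul (-1) (x - y) = y - x" for x y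
    by (simp add: seq_scale_def fun_eq_iff)
  show ?thesis
  proof
    show "0 \<le> norm_dist X N x y" for x y
      using S.subspace_diff[OF sub] N_nonneg by (simp add: norm_dist_def)
    show "norm_dist X N x y = norm_dist X N y x" for x y
      using S.subspace_diff[OF sub] N_scale[of "x - y" "-1"] by (simp add: norm_dist_def minus)
    show "norm_dist X N x y = 0 \<longleftrightarrow> x = y" if "x \<in> X" "y \<in> X" for x y
      using S.subspace_diff[OF sub] that N_eq_0_iff[of "x - y"] by (simp add: norm_dist_def)
    show "norm_dist X N x z \<le> norm_dist X N x y + norm_dist X N y z"
      if "x \<in> X" "y \<in> X" "z \<in> X" for x y z
      using S.subspace_diff[OF sub] that N_triangle[of "x - y" "y - z"]
      by (simp add: norm_dist_def)
  qed
qed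

lemma sup_norm_ge:
  assumes "bounded (range x)" shows "norm (x n) \<le> sup_norm x"
  unfolding sup_norm_def
  by (rule cSUP_upper) (use assms in \<open>auto simp: bounded_iff bdd_above_def\<close>)

lemma sup_norm_le: "(\<And>n. norm (x n) \<le> b) \<Longrightarrow> sup_norm x \<le> b"
  unfolding sup_norm_def by (rule cSUP_least) auto

lemma closed_dual_space:
  "closed (dual_space (smul :: 'k::real_normed_field \<Rightarrow> 'a::real_normed_vector \<Rightarrow> 'a))"
proof -
  have "dual_space smul =
      (\<Inter>c. \<Inter>v. {f. blinfun_apply f (smul c v) = c * blinfun_apply f v})"
    by (auto simp: dual_space_def)
  then show ?thesis
    by (auto intro!: closed_INT closed_Collect_eq continuous_intros)
qed

lemma banach_sequence_space_linf_dual: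
  fixes smul :: "'k::{real_normed_field,banach} \<Rightarrow> 'a::real_normed_vector \<Rightarrow> 'a"
  shows "banach_sequence_space dual_scale (linf (dual_space smul)) sup_norm"
proof -
  interpret D: normed_space_over "dual_scale :: 'k \<Rightarrow> ('a \<Rightarrow>\<^sub>L 'k) \<Rightarrow> _"
    by (rule normed_space_over_dual_scale)
  interpret S: vector_space "seq_scale (dual_scale :: 'k \<Rightarrow> ('a \<Rightarrow>\<^sub>L 'k) \<Rightarrow> _)"
    by (rule vector_space_seq_scale) unfold_locales
  let ?X = "linf (dual_space smul)"
  have dual_iff: "f \<in> dual_space smul \<longleftrightarrow>
      (\<forall>c v. blinfun_apply f (smul c v) = c * blinfun_apply f v)" for f
    by (simp add: dual_space_def)
  have X_iff: "x \<in> ?X \<longleftrightarrow> (\<forall>n. x n \<in> dual_space smul) \<and> (\<exists>b. \<forall>n. norm (x n) \<le> b)" for x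
    by (auto simp: linf_def bounded_iff)
  have bdd: "bounded (range x)" if "x \<in> ?X" for x
    using that by (simp add: linf_def)
  have add: "x + y \<in> ?X" if "x \<in> ?X" "y \<in> ?X" for x y
  proof -
    obtain b where "\<And>n. norm (x n) \<le> b" using \<open>x \<in> ?X\<close> by (auto simp: X_iff)
    moreover obtain c where "\<And>n. norm (y n) \<le> c" using \<open>y \<in> ?X\<close> by (auto simp: X_iff)
    ultimately have "\<And>n. norm ((x + y) n) \<le> b + c"
      by (auto intro: norm_triangle_mono)
    with that show ?thesis
      by (auto simp: X_iff dual_iff blinfun.add_left distrib_left)
  qed
  have scl: "seq_scale dual_scale c x \<in> ?X" if "x \<in> ?X" for c x
  proof -
    obtain b where "\<And>n. norm (x n) \<le> b"
      using \<open>x \<in> ?X\<close> by (auto simp: X_iff)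
    then have "\<And>n. norm (seq_scale dual_scale c x n) \<le> norm c * b"
      by (auto simp: seq_scale_def norm_dual_scale mult_left_mono)
    with that show ?thesis
      by (auto simp: X_iff dual_iff seq_scale_def)
  qed
  have sub: "S.subspace ?X"
    by (rule S.subspaceI) (auto intro: add scl, auto simp: X_iff dual_iff)
  note diff = S.subspace_diff[OF sub]
  have nonneg: "0 \<le> sup_norm x" if "x \<in> ?X" for x
    using sup_norm_ge[OF bdd[OF that], of 0] norm_ge_zero order_trans by blast
  have zero: "sup_norm x = 0 \<longleftrightarrow> x = 0" if "x \<in> ?X" for x
  proof
    assume "sup_norm x = 0"
    then show "x = 0"
      using sup_norm_ge[OF bdd[OF that]] by (auto simp: fun_eq_iff)
  qed (simp add: sup_norm_def)
  have tri: "sup_norm (x + y) \<le> sup_norm x + sup_norm y" if "x \<in> ?X" "y \<in> ?X" for x y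
    using that by (intro sup_norm_le) (auto intro!: norm_triangle_mono sup_norm_ge bdd)
  have scale_le: "sup_norm (seq_scale dual_scale c x) \<le> norm c * sup_norm x"
    if "x \<in> ?X" for c and x :: "nat \<Rightarrow> 'a \<Rightarrow>\<^sub>L 'k"
    using that by (intro sup_norm_le)
      (auto simp: seq_scale_def norm_dual_scale intro!: mult_left_mono sup_norm_ge bdd)
  have smul: "sup_norm (seq_scale dual_scale c x) = norm c * sup_norm x"
    if x: "x \<in> ?X" for c and x :: "nat \<Rightarrow> 'a \<Rightarrow>\<^sub>L 'k"
  proof (cases "c = 0")
    case True
    then show ?thesis
      by (simp add: seq_scale_def norm_dual_scale sup_norm_def)
  next
    case False
    then have "seq_scale dual_scale (inverse c) (seq_scale dual_scale c x) = x"
      by (simp add: fun_eq_iff)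
    then have "sup_norm x \<le> norm (inverse c) * sup_norm (seq_scale dual_scale c x)"
      using scale_le[OF scl[OF x], of "inverse c" c] by simp
    then have "norm c * sup_norm x \<le> sup_norm (seq_scale dual_scale c x)"
      using False by (simp add: norm_inverse pos_le_divide_eq mult.commute inverse_eq_divide norm_divide)
    with scale_le[OF x, of c] show ?thesis by simp
  qed
  have minus: "seq_scale dual_scale (-1) (x - y) = y - x" for x y :: "nat \<Rightarrow> 'a \<Rightarrow>\<^sub>L 'k"
    by (simp add: seq_scale_def fun_eq_iff)
  interpret M: Metric_space ?X "norm_dist ?X sup_norm"
  proof
    show "0 \<le> norm_dist ?X sup_norm x y" for x y
      using diff nonneg by (simp add: norm_dist_def)
    show "norm_dist ?X sup_norm x y = norm_dist ?X sup_norm y x" for x y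
      using diff smul[of "x - y" "-1"] by (simp add: norm_dist_def minus)
    show "norm_dist ?X sup_norm x y = 0 \<longleftrightarrow> x = y" if "x \<in> ?X" "y \<in> ?X" for x y
      using diff that zero[of "x - y"] by (simp add: norm_dist_def)
    show "norm_dist ?X sup_norm x z \<le> norm_dist ?X sup_norm x y + norm_dist ?X sup_norm y z"
      if "x \<in> ?X" "y \<in> ?X" "z \<in> ?X" for x y z
      using diff that tri[of "x - y" "y - z"] by (simp add: norm_dist_def)
  qed
  have complete: "M.mcomplete"
    unfolding M.mcomplete_def
  proof (intro allI impI)
    fix s assume "M.MCauchy s"
    then have sX: "\<And>k. s k \<in> ?X"
      by (auto simp: M.MCauchy_def)
    have cau: "\<exists>K. \<forall>k\<ge>K. \<forall>l\<ge>K. sup_norm (s k - s l) < e" if "e > 0" for e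
      using \<open>M.MCauchy s\<close> that sX unfolding M.MCauchy_def norm_dist_def
      by (simp; blast)
    have pt: "norm (s k n - s l n) \<le> sup_norm (s k - s l)" for k l n
      using sup_norm_ge[OF bdd[OF diff[OF sX sX]], of k l n] by simp
    have "Cauchy (\<lambda>k. s k n)" for n
    proof (rule CauchyI)
      fix e :: real assume "e > 0"
      then show "\<exists>K. \<forall>k\<ge>K. \<forall>l\<ge>K. norm (s k n - s l n) < e"
        using cau pt by (meson le_less_trans)
    qed
    then have "\<forall>n. \<exists>l. (\<lambda>k. s k n) \<longlonglongrightarrow> l"
      using Cauchy_convergent convergent_def by blast
    then obtain x where x: "\<And>n. (\<lambda>k. s k n) \<longlonglongrightarrow> x n"
      by (subst (asm) choice_iff) blast
    have close: "\<exists>K. \<forall>k\<ge>K. \<forall>n. norm (s k n - x n) \<le> e" if "e > 0" for e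
    proof -
      obtain K where K: "\<And>k l. k \<ge> K \<Longrightarrow> l \<ge> K \<Longrightarrow> sup_norm (s k - s l) < e"
        using cau[OF \<open>e > 0\<close>] by blast
      have "norm (s k n - x n) \<le> e" if "k \<ge> K" for k n
      proof (rule tendsto_upperbound)
        show "(\<lambda>l. norm (s k n - s l n)) \<longlonglongrightarrow> norm (s k n - x n)"
          by (intro tendsto_intros x)
        show "\<forall>\<^sub>F l in sequentially. norm (s k n - s l n) \<le> e"
          using K[OF \<open>k \<ge> K\<close>] pt
          by (intro eventually_sequentiallyI[of K]) (meson le_less_trans less_imp_le)
      qed simp
      then show ?thesis by blast
    qed
    have "x \<in> ?X"
    proof -
      have dual: "x n \<in> dual_space smul" for n
        by (rule closed_sequentially[OF closed_dual_space _ x]) (use sX X_iff in blast)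
      obtain K where K: "\<And>n. norm (s K n - x n) \<le> 1"
        using close[of 1] by auto
      obtain b where "\<And>n. norm (s K n) \<le> b"
        using sX[of K] by (auto simp: X_iff)
      then have "norm (x n) \<le> b + 1" for n
        using K[of n] by (smt (verit) norm_triangle_ineq2 norm_minus_commute)
      with dual show ?thesis by (auto simp: X_iff)
    qed
    moreover have "\<exists>K. \<forall>k\<ge>K. norm_dist ?X sup_norm (s k) x < e" if "e > 0" for e
    proof -
      obtain K where K: "\<And>k n. k \<ge> K \<Longrightarrow> norm (s k n - x n) \<le> e / 2"
        using close[of "e / 2"] \<open>e > 0\<close> half_gt_zero by blast
      have "sup_norm (s k - x) \<le> e / 2" if "k \<ge> K" for k
        using K[OF that] by (intro sup_norm_le) simp
      then show ?thesis
        using that sX \<open>x \<in> ?X\<close> by (intro exI[of _ K]) (fastforce simp: norm_dist_def)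
    qed
    ultimately show "\<exists>x. limitin M.mtopology s x sequentially"
      using sX by (auto simp: M.limitin_metric eventually_sequentially)
  qed
  show ?thesis
    by unfold_locales (fact sub nonneg zero tri smul complete)+
qed

end

theory Submission
  imports Defs "HOL-Library.Diagonal_Subsequence"
begin

text \<open>
  The subspaces come from a simple construction. Split the index set into infinitely many infinite
  fibres and multiply a seminormalized weak-star null sequence \<open>x\<close> on the \<open>k\<close>-th fibre by a scalar
  \<open>a k\<close>. For bounded \<open>a\<close> the result is again weak-star null; because \<open>norm (x n)\<close> is bounded below,
  it is not norm null as soon as one \<open>a k\<close> is nonzero, and the set of all
  these sequences is a closed infinite dimensional subspace.
  The constant multiplier 1 gives \<open>x\<close> back. A weak-star null sequence that is not norm null is bounded
  by the uniform boundedness principle, so it has a seminormalized subsequence to which the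
  construction applies.

  The hard part is that there is any weak-star null sequence that is not norm null: this is the
  Josefson--Nissenzweig theorem. Its proof is first given for real scalars. Take functionals \<open>y n\<close> of
  norm at most 1 with mutual distances at least 1. If some subsequence converges pointwise, the
  differences of its consecutive terms are as desired. Otherwise a subsequence is equivalent to the
  unit vector basis of \<open>\<ell>\<^sub>1\<close> (\<open>rosenthal_ell1\<close>), so that all \<open>\<ell>\<^sub>1\<close>-normalized blocks of
  it have norm at least some \<open>c > 0\<close>. Among the sequences of such blocks with supports moving to
  infinity, choose one, \<open>z\<close>, for which the supremum \<open>d\<close> over the unit ball of
  \<open>limsup \<bar>z j v\<bar>\<close> cannot be decreased by passing to further blocks (\<open>ex_stable\<close>). If \<open>d = 0\<close>,
  then \<open>z\<close> itself is weak-star null.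

  If \<open>d > 0\<close>, consider finitely many infinite index sets. A block that averages differences of terms
  with indices from these sets still reaches \<open>d\<close> asymptotically, and no single term can exceed \<open>d\<close>
  by much; so at a suitable vector all the terms involved are close to \<open>d\<close> or \<open>- d\<close> with the
  prescribed signs, and each of the index sets splits into two infinite parts
  (\<open>ex_splitting_vector\<close>). Iteration yields vectors \<open>x i\<close> in the unit ball on which, for each \<open>m\<close>,
  functionals of norm at most 1 realize all sign patterns of length \<open>m\<close>. Averaging these functionals
  against Rademacher functions gives functionals which satisfy Bessel's inequality at every vector
  and are at least \<open>d / 2\<close> at \<open>x i\<close>. A weak-star cluster point for \<open>m\<close> tending to infinity inherits
  both properties: the first makes it weak-star null, the second keeps it away from 0 in norm
  (\<open>independent_imp_weak_star_null\<close>).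

  Complex spaces reduce to real ones by \<open>f \<mapsto> (\<lambda>v. f v - \<i> f (\<i> v))\<close>.
\<close>


section \<open>The Hahn--Banach theorem\<close>

text \<open>
  For positive factors the inequality already implies equality, and \<open>p 0 = 0\<close> follows; demanding
  only inequalities shortens the proofs that infima are sublinear.
\<close>

definition sublinear :: "('a::real_vector \<Rightarrow> real) \<Rightarrow> bool" where
  "sublinear p \<longleftrightarrow> (\<forall>x y. p (x + y) \<le> p x + p y) \<and> (\<forall>c>0. \<forall>x. p (c *\<^sub>R x) \<le> c * p x)"

lemma sublinear_add: "sublinear p \<Longrightarrow> p (x + y) \<le> p x + p y"
  by (simp add: sublinear_def)

lemma sublinear_zero:
  assumes "sublinear p" shows "p 0 = 0"
proof -
  have "p ((1/2) *\<^sub>R 0) \<le> (1/2) * p 0"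
    using assms unfolding sublinear_def by (metis half_gt_zero zero_less_one)
  then show ?thesis using sublinear_add[OF assms, of 0 0] by simp
qed

lemma sublinear_scale:
  assumes "sublinear p" "c \<ge> 0" shows "p (c *\<^sub>R x) = c * p x"
proof (cases "c = 0")
  case True then show ?thesis by (simp add: sublinear_zero[OF assms(1)])
next
  case False
  then have c: "c > 0" using assms(2) by simp
  have "p (inverse c *\<^sub>R (c *\<^sub>R x)) \<le> inverse c * p (c *\<^sub>R x)"
    using assms(1) c unfolding sublinear_def by (metis positive_imp_inverse_positive)
  then have "c * p x \<le> p (c *\<^sub>R x)" using c by (simp add: field_simps)
  moreover have "p (c *\<^sub>R x) \<le> c * p x" using assms(1) c by (simp add: sublinear_def)
  ultimately show ?thesis by simp
qed

lemma sublinear_ge: "sublinear p \<Longrightarrow> - p (- x) \<le> p x"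
  using sublinear_add[of p x "- x"] sublinear_zero[of p] by simp

lemma sublinear_norm: "sublinear norm"
  by (simp add: sublinear_def norm_triangle_ineq)

text \<open>
  For sublinear \<open>p\<close>, this is the largest sublinear functional below \<open>p\<close> whose value at \<open>- y\<close> is at
  most \<open>- p y\<close>. A
  functional that coincides with all its tilts is therefore odd, and hence linear.
\<close>

definition tilt :: "('a::real_vector \<Rightarrow> real) \<Rightarrow> 'a \<Rightarrow> 'a \<Rightarrow> real" where
  "tilt p y x = (INF t\<in>{0..}. p (x + t *\<^sub>R y) - t * p y)"

lemma tilt_le:
  assumes "sublinear p" "t \<ge> 0"
  shows "tilt p y x \<le> p (x + t *\<^sub>R y) - t * p y"
  unfolding tilt_def
proof (rule cINF_lower)
  have "- p (- x) \<le> p (x + t *\<^sub>R y) - t * p y" if "t \<ge> 0" for t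
    using sublinear_add[OF assms(1), of "x + t *\<^sub>R y" "- x"]
      sublinear_scale[OF assms(1) that, of y] by simp
  then show "bdd_below ((\<lambda>t. p (x + t *\<^sub>R y) - t * p y) ` {0..})"
    by (auto intro!: bdd_belowI)
qed (use assms in simp)

lemma tilt_ge:
  "(\<And>t. t \<ge> 0 \<Longrightarrow> b \<le> p (x + t *\<^sub>R y) - t * p y) \<Longrightarrow> b \<le> tilt p y x"
  unfolding tilt_def by (rule cINF_greatest) auto

lemma sublinear_tilt:
  assumes p: "sublinear p"
  shows "sublinear (tilt p y)"
  unfolding sublinear_def
proof (intro conjI allI impI)
  fix x x'
  have "tilt p y (x + x') - (p (x' + t' *\<^sub>R y) - t' * p y) \<le> p (x + t *\<^sub>R y) - t * p y"
    if "t \<ge> 0" "t' \<ge> 0" for t t'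
    using tilt_le[OF p, of "t + t'" y "x + x'"] that
      sublinear_add[OF p, of "x + t *\<^sub>R y" "x' + t' *\<^sub>R y"]
    by (simp add: algebra_simps)
  then have "tilt p y (x + x') - (p (x' + t' *\<^sub>R y) - t' * p y) \<le> tilt p y x" if "t' \<ge> 0" for t'
    using that by (intro tilt_ge) auto
  then have "tilt p y (x + x') - tilt p y x \<le> tilt p y x'"
    by (intro tilt_ge) (simp add: algebra_simps)
  then show "tilt p y (x + x') \<le> tilt p y x + tilt p y x'" by simp
next
  fix c :: real and x assume c: "c > 0"
  have "inverse c * tilt p y (c *\<^sub>R x) \<le> tilt p y x"
  proof (rule tilt_ge)
    fix t :: real assume "t \<ge> 0"
    then have "tilt p y (c *\<^sub>R x) \<le> p (c *\<^sub>R x + (c * t) *\<^sub>R y) - (c * t) * p y"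
      using c by (intro tilt_le[OF p]) simp
    also have "\<dots> = c * (p (x + t *\<^sub>R y) - t * p y)"
      using sublinear_scale[OF p, of c "x + t *\<^sub>R y"] c by (simp add: algebra_simps)
    finally show "inverse c * tilt p y (c *\<^sub>R x) \<le> p (x + t *\<^sub>R y) - t * p y"
      using c by (simp add: field_simps)
  qed
  then show "tilt p y (c *\<^sub>R x) \<le> c * tilt p y x" using c by (simp add: field_simps)
qed

lemma tilt_le_self: "sublinear p \<Longrightarrow> tilt p y x \<le> p x"
  using tilt_le[of p 0 y x] by simp

lemma tilt_minus_le: "sublinear p \<Longrightarrow> tilt p y (- y) \<le> - p y"
  using tilt_le[of p 1 y "- y"] sublinear_zero[of p] by simp

text \<open>
  Zorn's lemma. The pointwise infimum of a chain is finite because \<open>- p0 (- x)\<close> is a common lower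
  bound at \<open>x\<close>, and it is subadditive because two members of the chain can be replaced by the smaller
  one.
\<close>

lemma ex_minimal_sublinear:
  assumes "sublinear p0"
  obtains m where "sublinear m" "m \<le> p0" "\<And>q. sublinear q \<Longrightarrow> q \<le> m \<Longrightarrow> q = m"
proof -
  let ?A = "{p. sublinear p \<and> p \<le> p0}"
  let ?R = "\<lambda>p q. q \<le> (p :: 'a \<Rightarrow> real)"
  have "\<exists>m\<in>?A. \<forall>a\<in>?A. ?R m a \<longrightarrow> a = m"
  proof (rule predicate_Zorn)
    show "partial_order_on ?A (relation_of ?R ?A)"
      by (rule partial_order_on_relation_ofI) auto
  next
    fix C assume C: "C \<in> Chains (relation_of ?R ?A)"
    show "\<exists>u\<in>?A. \<forall>a\<in>C. ?R a u"
    proof (cases "C = {}")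
      case True then show ?thesis using assms by auto
    next
      case False
      have sub: "sublinear p" "p \<le> p0" if "p \<in> C" for p
        using C that unfolding Chains_def relation_of_def by auto
      have lin: "p \<le> q \<or> q \<le> p" if "p \<in> C" "q \<in> C" for p q
        using C that unfolding Chains_def relation_of_def by auto
      define u where "u x = (INF p\<in>C. p x)" for x
      have "- p0 (- x) \<le> p x" if "p \<in> C" for p x
        using sublinear_ge[OF sub(1)[OF that], of x] le_funD[OF sub(2)[OF that], of "- x"] by simp
      then have bdd: "bdd_below ((\<lambda>p. p x) ` C)" for x
        by (auto intro!: bdd_belowI)
      have u_le: "u x \<le> p x" if "p \<in> C" for p x
        unfolding u_def by (rule cINF_lower[OF bdd that])
      have u_ge: "b \<le> u x" if "\<And>p. p \<in> C \<Longrightarrow> b \<le> p x" for b x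
        unfolding u_def using False that by (rule cINF_greatest)
      have "sublinear u"
        unfolding sublinear_def
      proof (intro conjI allI impI)
        fix x y
        have "u (x + y) - q y \<le> p x" if "p \<in> C" "q \<in> C" for p q
          using lin[OF that]
        proof
          assume "p \<le> q"
          then show ?thesis
            using u_le[OF that(1), of "x + y"] sublinear_add[OF sub(1)[OF that(1)], of x y]
              le_funD[of p q y] by simp
        next
          assume "q \<le> p"
          then show ?thesis
            using u_le[OF that(2), of "x + y"] sublinear_add[OF sub(1)[OF that(2)], of x y]
              le_funD[of q p x] by simp
        qed
        then have "u (x + y) - q y \<le> u x" if "q \<in> C" for q
          using that by (intro u_ge) auto
        then have "u (x + y) - u x \<le> u y"
          by (intro u_ge) (simp add: algebra_simps)
        then show "u (x + y) \<le> u x + u y" by simp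
      next
        fix c :: real and x assume c: "c > 0"
        have "inverse c * u (c *\<^sub>R x) \<le> u x"
        proof (rule u_ge)
          fix p assume p: "p \<in> C"
          show "inverse c * u (c *\<^sub>R x) \<le> p x"
            using u_le[OF p, of "c *\<^sub>R x"] sublinear_scale[OF sub(1)[OF p], of c x] c
            by (simp add: field_simps)
        qed
        then show "u (c *\<^sub>R x) \<le> c * u x" using c by (simp add: field_simps)
      qed
      moreover have "u \<le> p0"
        using False u_le sub(2) by (metis ex_in_conv le_fun_def order_trans)
      ultimately show ?thesis using u_le by (auto simp: le_fun_def)
    qed
  qed
  then show ?thesis using that by (auto intro: order_trans)
qed

text \<open>
  Minimality forces \<open>tilt m y = m\<close> for every \<open>y\<close>, and this is the missing inequality
  \<open>m x \<le> m (x + y) - m y\<close>.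
\<close>

lemma minimal_sublinear_linear:
  assumes m: "sublinear m" and min: "\<And>q. sublinear q \<Longrightarrow> q \<le> m \<Longrightarrow> q = m"
  shows "linear m"
proof -
  have tilt: "tilt m y = m" for y
    by (rule min[OF sublinear_tilt[OF m]]) (simp add: le_fun_def tilt_le_self[OF m])
  have add: "m (x + y) = m x + m y" for x y
    using tilt_le[OF m, of 1 y x] sublinear_add[OF m, of x y] by (simp add: tilt)
  have neg: "m (- x) = - m x" for x
    using add[of x "- x"] sublinear_zero[OF m] by simp
  show ?thesis
  proof (rule linearI[OF add])
    fix c x
    show "m (c *\<^sub>R x) = c *\<^sub>R m x"
      using sublinear_scale[OF m, of c x] sublinear_scale[OF m, of "- c" x] neg[of "c *\<^sub>R x"]
      by (cases "c \<ge> 0") auto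
  qed
qed

text \<open>
  A minimal sublinear functional below the norm has norm at most 1. Starting from \<open>tilt norm x\<close>
  instead of the norm forces the value \<open>- norm x\<close> at \<open>- x\<close>.
\<close>

theorem ex_norming_functional:
  fixes x :: "'a::real_normed_vector"
  obtains f :: "'a \<Rightarrow>\<^sub>L real" where "norm f \<le> 1" "blinfun_apply f x = norm x"
proof -
  obtain m where m: "sublinear m" "m \<le> tilt norm x" and lin: "linear m"
    using ex_minimal_sublinear[OF sublinear_tilt[OF sublinear_norm], of x]
      minimal_sublinear_linear by metis
  have le: "m v \<le> norm v" for v
    using le_funD[OF m(2), of v] tilt_le_self[OF sublinear_norm, of x v] by simp
  have neg: "m (- v) = - m v" for v by (rule linear_neg[OF lin])
  have abs: "\<bar>m v\<bar> \<le> norm v" for v using le[of v] le[of "- v"] by (simp add: neg)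
  then have bl: "bounded_linear m"
    using lin by (intro bounded_linear_intro[where K = 1]) (auto simp: linear_add linear_scale)
  have "norm (Blinfun m) \<le> 1"
    using abs by (intro norm_blinfun_bound) (auto simp: bounded_linear_Blinfun_apply[OF bl])
  moreover have "m x = norm x"
    using le_funD[OF m(2), of "- x"] tilt_minus_le[OF sublinear_norm, of x] le[of x]
    by (simp add: neg)
  ultimately show ?thesis using that bounded_linear_Blinfun_apply[OF bl] by metis
qed

section \<open>Separated sequences of functionals\<close>

text \<open>
  One new functional costs at most one new dimension: if it does not vanish on the common kernel of
  the others, a vector \<open>k\<close> of that kernel where it is nonzero is added to the complement.
\<close>

lemma finite_complement_of_kernels:
  fixes F :: "('a::real_normed_vector \<Rightarrow>\<^sub>L real) set"
  assumes "finite F"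
  shows "\<exists>S. finite S \<and> (\<forall>x. \<exists>s\<in>span S. \<forall>f\<in>F. blinfun_apply f (x - s) = 0)"
  using assms
proof (induction F)
  case empty
  show ?case by (intro exI[of _ "{}"]) auto
next
  case (insert g F)
  then obtain S where S: "finite S" "\<And>x. \<exists>s\<in>span S. \<forall>f\<in>F. blinfun_apply f (x - s) = 0"
    by blast
  show ?case
  proof (cases "\<exists>k. (\<forall>f\<in>F. blinfun_apply f k = 0) \<and> blinfun_apply g k \<noteq> 0")
    case True
    then obtain k where k: "\<And>f. f \<in> F \<Longrightarrow> blinfun_apply f k = 0" "blinfun_apply g k \<noteq> 0" by blast
    have "\<exists>s\<in>span (insert k S). \<forall>f\<in>insert g F. blinfun_apply f (x - s) = 0" for x
    proof -
      obtain s where s: "s \<in> span S" "\<And>f. f \<in> F \<Longrightarrow> blinfun_apply f (x - s) = 0" using S(2) by blast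
      let ?s = "s + (blinfun_apply g (x - s) / blinfun_apply g k) *\<^sub>R k"
      have "?s \<in> span (insert k S)"
        using s(1) span_mono[of S "insert k S"]
        by (auto intro!: span_add span_scale intro: span_base)
      moreover have "blinfun_apply f (x - ?s) = 0" if "f \<in> insert g F" for f
        using that k s(2)[of f] by (auto simp: blinfun.diff_right blinfun.add_right blinfun.scaleR_right)
      ultimately show ?thesis by blast
    qed
    then show ?thesis using S(1) by (intro exI[of _ "insert k S"]) auto
  next
    case False
    then show ?thesis using S by (metis insert_iff)
  qed
qed

lemma ex_common_kernel:
  fixes F :: "('a::real_normed_vector \<Rightarrow>\<^sub>L real) set"
  assumes "infinite_dimensional scaleR (UNIV :: 'a set)" "finite F"
  obtains x where "norm x = 1" "\<And>f. f \<in> F \<Longrightarrow> blinfun_apply f x = 0"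
proof -
  obtain S where S: "finite S" "\<And>x. \<exists>s\<in>span S. \<forall>f\<in>F. blinfun_apply f (x - s) = 0"
    using finite_complement_of_kernels[OF assms(2)] by blast
  obtain x where x: "x \<notin> span S"
    using assms(1) S(1) unfolding infinite_dimensional_def span_raw_def by blast
  obtain s where s: "s \<in> span S" "\<And>f. f \<in> F \<Longrightarrow> blinfun_apply f (x - s) = 0" using S(2) by blast
  have "x - s \<noteq> 0" using x s(1) by auto
  then show ?thesis
    using that[of "(1 / norm (x - s)) *\<^sub>R (x - s)"] s(2) by (simp add: blinfun.scaleR_right)
qed

text \<open>
  Choose \<open>y n\<close> to norm a unit vector in the common kernel of all earlier functionals; at this vector
  \<open>y n\<close> is 1 and the earlier ones are 0.
\<close>

proposition ex_separated_functionals: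
  assumes "infinite_dimensional scaleR (UNIV :: 'a::real_normed_vector set)"
  obtains y :: "nat \<Rightarrow> 'a::real_normed_vector \<Rightarrow>\<^sub>L real"
    where "\<And>n. norm (y n) \<le> 1" "\<And>m n. m \<noteq> n \<Longrightarrow> 1 \<le> norm (y m - y n)"
proof -
  have ex: "\<exists>f. norm f \<le> 1 \<and> (\<forall>g\<in>F. 1 \<le> norm (f - g))" if F: "finite F"
    for F :: "('a \<Rightarrow>\<^sub>L real) set"
  proof -
    obtain x where x: "norm x = 1" "\<And>f. f \<in> F \<Longrightarrow> blinfun_apply f x = 0"
      using ex_common_kernel[OF assms F] by metis
    obtain f :: "'a \<Rightarrow>\<^sub>L real" where f: "norm f \<le> 1" "blinfun_apply f x = norm x"
      by (rule ex_norming_functional)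
    have "1 \<le> norm (f - g)" if "g \<in> F" for g
      using norm_blinfun[of "f - g" x] x f(2) that by (simp add: blinfun.diff_left)
    then show ?thesis using f(1) by blast
  qed
  have "\<exists>y::nat \<Rightarrow> 'a \<Rightarrow>\<^sub>L real. \<forall>n. norm (y n) \<le> 1 \<and> (\<forall>m<n. 1 \<le> norm (y n - y m))"
  proof (rule dependent_wellorder_choice)
    fix n and y :: "nat \<Rightarrow> 'a \<Rightarrow>\<^sub>L real"
    show "\<exists>f. norm f \<le> 1 \<and> (\<forall>m<n. 1 \<le> norm (f - y m))"
      using ex[of "y ` {..<n}"] by auto
  qed auto
  then obtain y :: "nat \<Rightarrow> 'a \<Rightarrow>\<^sub>L real"
    where y: "\<And>n. norm (y n) \<le> 1" "\<And>m n. m < n \<Longrightarrow> 1 \<le> norm (y n - y m)" by blast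
  have "1 \<le> norm (y m - y n)" if "m \<noteq> n" for m n
    using y(2)[of m n] y(2)[of n m] that by (cases "m < n") (auto simp: norm_minus_commute)
  with y(1) show ?thesis by (rule that)
qed

section \<open>Independent sequences of pairs of sets\<close>

text \<open>
  Think of \<open>good\<close> as a property of finite families of cells that is strong enough to survive a
  simultaneous splitting of all cells by one well-chosen pair of sets and that excludes empty cells.
  The construction is used twice: for sets of vectors split by functionals, and for sets of indices
  of functionals split by vectors.
\<close>

lemma independent_sequence:
  fixes A B :: "'p \<Rightarrow> 'x set" and good :: "'x set set \<Rightarrow> bool"
  assumes init: "good {UNIV}"
    and step: "\<And>\<S>. good \<S> \<Longrightarrow> \<exists>p\<in>P. good (\<Union>S\<in>\<S>. {S \<inter> A p, S \<inter> B p})"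
    and ne: "\<And>\<S> S. good \<S> \<Longrightarrow> S \<in> \<S> \<Longrightarrow> S \<noteq> {}"
  shows "\<exists>p :: nat \<Rightarrow> 'p. (\<forall>k. p k \<in> P) \<and>
    (\<forall>m I. (\<Inter>i<m. if i \<in> I then A (p i) else B (p i)) \<noteq> {})"
proof -
  define refine where "refine \<S> p = (\<Union>S\<in>\<S>. {S \<inter> A p, S \<inter> B p})" for \<S> p
  have "\<exists>f. \<forall>n::nat. (good (fst (f n)) \<and> snd (f n) \<in> P \<and> good (refine (fst (f n)) (snd (f n)))
            \<and> (n = 0 \<longrightarrow> fst (f n) = {UNIV}))
          \<and> fst (f (Suc n)) = refine (fst (f n)) (snd (f n))"
  proof (rule dependent_nat_choice)
    obtain p where "p \<in> P" "good (refine {UNIV} p)" using step[OF init] by (auto simp: refine_def)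
    then show "\<exists>x. good (fst x) \<and> snd x \<in> P \<and> good (refine (fst x) (snd x)) \<and>
        ((0::nat) = 0 \<longrightarrow> fst x = {UNIV})"
      using init by (intro exI[of _ "({UNIV}, p)"]) simp
  next
    fix x :: "'x set set \<times> 'p" and n :: nat
    assume x: "good (fst x) \<and> snd x \<in> P \<and> good (refine (fst x) (snd x)) \<and> (n = 0 \<longrightarrow> fst x = {UNIV})"
    then obtain p where "p \<in> P" "good (refine (refine (fst x) (snd x)) p)"
      using step[of "refine (fst x) (snd x)"] by (auto simp: refine_def[of "refine (fst x) (snd x)"])
    then show "\<exists>y. (good (fst y) \<and> snd y \<in> P \<and> good (refine (fst y) (snd y)) \<and>
        (Suc n = 0 \<longrightarrow> fst y = {UNIV})) \<and> fst y = refine (fst x) (snd x)"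
      using x by (intro exI[of _ "(refine (fst x) (snd x), p)"]) simp
  qed
  then obtain f where f: "\<And>n. good (fst (f n))" "\<And>n. snd (f n) \<in> P" "fst (f 0) = {UNIV}"
    "\<And>n. fst (f (Suc n)) = refine (fst (f n)) (snd (f n))" by blast
  define p where "p = snd \<circ> f"
  have "(\<Inter>i<m. if i \<in> I then A (p i) else B (p i)) \<in> fst (f m)" for m I
  proof (induction m)
    case 0 show ?case by (simp add: f(3))
  next
    case (Suc m)
    have "(\<Inter>i<Suc m. if i \<in> I then A (p i) else B (p i)) =
        (\<Inter>i<m. if i \<in> I then A (p i) else B (p i)) \<inter> (if m \<in> I then A (p m) else B (p m))"
      by (auto simp: less_Suc_eq)
    with Suc show ?case unfolding f(4) refine_def p_def o_def by (auto split: if_splits)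
  qed
  with f(1) ne have cells: "(\<Inter>i<m. if i \<in> I then A (p i) else B (p i)) \<noteq> {}" for m I by blast
  have "p k \<in> P" for k using f(2) by (simp add: p_def)
  then show ?thesis using cells by (intro exI[of _ p]) simp
qed

text \<open>
  The quantification over all infinite \<open>L\<close> makes the property pass to infinite subsets of \<open>M\<close>: no
  subsequence of the pairs \<open>(A n, B n)\<close> with indices in \<open>M\<close> settles down at all points of \<open>S\<close>.
\<close>

definition oscillates :: "(nat \<Rightarrow> 'x set) \<Rightarrow> (nat \<Rightarrow> 'x set) \<Rightarrow> 'x set \<Rightarrow> nat set \<Rightarrow> bool" where
  "oscillates A B S M \<longleftrightarrow> (\<forall>L\<subseteq>M. infinite L \<longrightarrow>
     (\<exists>x\<in>S. infinite {n\<in>L. x \<in> A n} \<and> infinite {n\<in>L. x \<in> B n}))"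

text \<open>
  If this fails, then each \<open>n\<close> and each infinite set of indices admit a half \<open>S \<inter> A n\<close> or
  \<open>S \<inter> B n\<close> of one of the cells and an infinite subset along which no point of that half
  oscillates. Choose indices \<open>n k\<close> in a decreasing sequence of such subsets. As there are finitely
  many cells, the same cell \<open>S\<close> and the same side occur for infinitely many \<open>k\<close>. A point of \<open>S\<close> that
  oscillates along these \<open>n k\<close> lies in one of the halves, where it does not oscillate.
\<close>

lemma oscillates_refine:
  assumes fin: "finite \<S>" and M: "infinite M" and osc: "\<And>S. S \<in> \<S> \<Longrightarrow> oscillates A B S M"
  shows "\<exists>n L. infinite L \<and> L \<subseteq> M \<and>
    (\<forall>S\<in>\<S>. oscillates A B (S \<inter> A n) L \<and> oscillates A B (S \<inter> B n) L)"
proof (rule ccontr)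
  assume contra: "\<not> ?thesis"
  define C where "C b n = (if b then A n else B n)" for b n
  define bad where "bad n S b L \<longleftrightarrow> infinite L \<and> S \<in> \<S> \<and>
      (\<forall>x\<in>S \<inter> C b n. finite {n\<in>L. x \<in> A n} \<or> finite {n\<in>L. x \<in> B n})" for n S b L
  have ex_bad: "\<exists>S b L'. L' \<subseteq> L \<and> bad n S b L'" if L: "infinite L" "L \<subseteq> M" for n L
  proof -
    obtain S where "S \<in> \<S>" "\<not> oscillates A B (S \<inter> A n) L \<or> \<not> oscillates A B (S \<inter> B n) L"
      using contra L by blast
    then obtain b where "\<not> oscillates A B (S \<inter> C b n) L"
      unfolding C_def by metis
    then show ?thesis using \<open>S \<in> \<S>\<close> unfolding oscillates_def bad_def by blast
  qed
  let ?P = "\<lambda>(n, S, b, L). n \<in> M \<and> L \<subseteq> M \<and> bad n S b L"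
  let ?Q = "\<lambda>(n, S, b, L) (n', S', b', L'). n' \<in> L \<and> n < n' \<and> L' \<subseteq> L"
  have "\<exists>f. \<forall>k::nat. ?P (f k) \<and> ?Q (f k) (f (Suc k))"
  proof (rule dependent_nat_choice)
    obtain n where "n \<in> M" using M by fastforce
    then show "\<exists>x. ?P x"
      using ex_bad[OF M order_refl] by fastforce
  next
    fix x :: "nat \<times> 'a set \<times> bool \<times> nat set" and k :: nat
    obtain n S b L where x: "x = (n, S, b, L)" by (metis prod_cases4)
    assume "?P x"
    then have L: "L \<subseteq> M" "infinite L" by (auto simp: x bad_def)
    then obtain n' where n': "n' \<in> L" "n < n'" by (meson infinite_nat_iff_unbounded)
    obtain S' b' L' where "L' \<subseteq> L" "bad n' S' b' L'" using ex_bad[OF L(2,1)] by blast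
    then show "\<exists>x'. ?P x' \<and> ?Q x x'"
      using n' L by (intro exI[of _ "(n', S', b', L')"]) (auto simp: x)
  qed
  then obtain f where f: "\<forall>k. ?P (f k) \<and> ?Q (f k) (f (Suc k))" ..
  define n where "n k = fst (f k)" for k
  define S where "S k = fst (snd (f k))" for k
  define b where "b k = fst (snd (snd (f k)))" for k
  define L where "L k = snd (snd (snd (f k)))" for k
  have feq: "f k = (n k, S k, b k, L k)" for k by (simp add: n_def S_def b_def L_def)
  have nM: "n k \<in> M" and bad: "bad (n k) (S k) (b k) (L k)" for k
    using spec[OF f, of k] by (auto simp: feq)
  have nL: "n (Suc k) \<in> L k" and n_less: "n k < n (Suc k)" and L_Suc: "L (Suc k) \<subseteq> L k" for k
    using spec[OF f, of k] by (auto simp: feq)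
  have mono: "strict_mono n" by (simp add: strict_mono_Suc_iff n_less)
  have L_anti: "L k \<subseteq> L j" if "j \<le> k" for j k
    using that lift_Suc_antimono_le[of L] L_Suc by blast
  have n_in: "n j \<in> L k" if "k < j" for j k
    using that nL[of "j - 1"] L_anti[of k "j - 1"] by (cases j) auto
  have "finite (range (\<lambda>k. (S k, b k)))"
    using bad by (intro finite_subset[OF _ finite_cartesian_product[OF fin, of "UNIV :: bool set"]])
      (auto simp: bad_def)
  then obtain k0 where k0: "infinite {k. (S k, b k) = (S k0, b k0)}"
    using pigeonhole_infinite[of "UNIV :: nat set" "\<lambda>k. (S k, b k)"] by auto
  define K where "K = {k. (S k, b k) = (S k0, b k0)}"
  have "infinite (n ` K)"
    using k0 mono by (simp add: K_def finite_image_iff strict_mono_imp_inj_on)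
  moreover have nK: "n ` K \<subseteq> M" using nM by auto
  moreover have "S k0 \<in> \<S>" using bad by (auto simp: bad_def)
  ultimately obtain x where x: "x \<in> S k0" "infinite {j\<in>n ` K. x \<in> A j}" "infinite {j\<in>n ` K. x \<in> B j}"
    using osc[unfolded oscillates_def, THEN spec, THEN mp, OF _ nK] by blast
  then have "infinite {j\<in>n ` K. x \<in> C (b k0) j}" by (cases "b k0") (simp_all add: C_def)
  then obtain k where k: "k \<in> K" "x \<in> C (b k0) (n k)" by (force dest!: infinite_imp_nonempty)
  \<comment> \<open>Up to finitely many terms, the chosen indices lie in every \<open>L k\<close>.\<close>
  have tail: "infinite {j\<in>L k. x \<in> D j}" if "infinite {j\<in>n ` K. x \<in> D j}" for D
  proof
    assume "finite {j\<in>L k. x \<in> D j}"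
    moreover have "{j\<in>n ` K. x \<in> D j} \<subseteq> n ` {..k} \<union> {j\<in>L k. x \<in> D j}"
      using n_in by auto (meson atMost_iff imageI not_le)
    ultimately show False using that finite_subset by blast
  qed
  have "S k = S k0" "b k = b k0" using k(1) by (auto simp: K_def)
  then show False
    using bad[of k] tail[OF x(2)] tail[OF x(3)] x(1) k(2) by (auto simp: bad_def)
qed

text \<open>
  There is room for two levels between the limit of a convergent subsequence and the infinitely many
  terms that stay away from it. Rational levels keep the number of possible pairs countable.
\<close>

lemma bounded_oscillation:
  fixes g :: "nat \<Rightarrow> real"
  assumes bdd: "\<And>n. \<bar>g n\<bar> \<le> c" and "\<not> convergent g"
  obtains a b :: rat where "a < b" "infinite {n. of_rat b < g n}" "infinite {n. g n < of_rat a}"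
proof -
  have "bounded (range g)" using bdd by (auto simp: bounded_iff)
  then obtain l r where r: "strict_mono (r :: nat \<Rightarrow> nat)" "(g \<circ> r) \<longlonglongrightarrow> l"
    using bounded_imp_convergent_subsequence by blast
  have "\<not> g \<longlonglongrightarrow> l" using assms(2) by (auto simp: convergent_def)
  then obtain e where e: "e > 0" "\<And>N. \<exists>n\<ge>N. e \<le> \<bar>g n - l\<bar>"
    unfolding LIMSEQ_iff by (force simp: not_less)
  then have "infinite {n. e \<le> \<bar>g n - l\<bar>}" by (auto simp: infinite_nat_iff_unbounded_le)
  moreover have "{n. e \<le> \<bar>g n - l\<bar>} \<subseteq> {n. g n \<ge> l + e} \<union> {n. g n \<le> l - e}" by auto
  ultimately consider "infinite {n. g n \<ge> l + e}" | "infinite {n. g n \<le> l - e}"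
    by (meson finite_Un infinite_super)
  then show ?thesis
  proof cases
    case 1
    obtain a b :: rat where ab: "l < of_rat a" "(of_rat a :: real) < of_rat b" "of_rat b < l + e"
      using e(1) of_rat_dense by (metis less_add_same_cancel1)
    have "eventually (\<lambda>n. (g \<circ> r) n < of_rat a) sequentially"
      by (rule order_tendstoD(2)[OF r(2) ab(1)])
    then have "infinite {n. (g \<circ> r) n < of_rat a}"
      using infinite_nat_iff_unbounded_le eventually_sequentially by (metis (mono_tags, lifting) le_cases mem_Collect_eq)
    then have "infinite (r ` {n. (g \<circ> r) n < of_rat a})"
      using r(1) by (simp add: finite_image_iff strict_mono_imp_inj_on)
    then have "infinite {n. g n < of_rat a}" by (rule infinite_super[rotated]) auto
    moreover have "infinite {n. of_rat b < g n}" using ab(3) by (intro infinite_super[OF _ 1]) auto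
    ultimately show ?thesis using that ab(2) by (metis of_rat_less)
  next
    case 2
    obtain a b :: rat where ab: "l - e < of_rat a" "(of_rat a :: real) < of_rat b" "of_rat b < l"
      using e(1) of_rat_dense by (metis diff_less_eq less_add_same_cancel1)
    have "eventually (\<lambda>n. (g \<circ> r) n > of_rat b) sequentially"
      by (rule order_tendstoD(1)[OF r(2) ab(3)])
    then have "infinite {n. (g \<circ> r) n > of_rat b}"
      using infinite_nat_iff_unbounded_le eventually_sequentially by (metis (mono_tags, lifting) le_cases mem_Collect_eq)
    then have "infinite (r ` {n. (g \<circ> r) n > of_rat b})"
      using r(1) by (simp add: finite_image_iff strict_mono_imp_inj_on)
    then have "infinite {n. g n > of_rat b}" by (rule infinite_super[rotated]) auto
    moreover have "infinite {n. g n < of_rat a}" using ab(1) by (intro infinite_super[OF _ 2]) auto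
    ultimately show ?thesis using that ab(2) by (metis of_rat_less)
  qed
qed

lemma infinite_vimage_strict_mono:
  "strict_mono (r :: nat \<Rightarrow> nat) \<Longrightarrow> infinite {n. Q (r n)} \<Longrightarrow> infinite {n. Q n}"
  using finite_vimageI[of "{n. Q n}" r] strict_mono_imp_inj_on[of r] by (auto simp: vimage_def)

text \<open>
  If every pair of rational levels could be calmed down by passing to a subsequence of any given
  sequence, a diagonal sequence would not oscillate between any such levels at any point, and hence
  it would converge pointwise on \<open>X\<close>.
\<close>

proposition ex_stable_oscillation:
  fixes f :: "nat \<Rightarrow> 'x \<Rightarrow> real"
  assumes bdd: "\<And>n x. x \<in> X \<Longrightarrow> \<bar>f n x\<bar> \<le> c"
    and noconv: "\<And>r. strict_mono (r :: nat \<Rightarrow> nat) \<Longrightarrow> \<exists>x\<in>X. \<not> convergent (\<lambda>n. f (r n) x)"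
  shows "\<exists>a b M. a < b \<and> infinite M \<and>
    oscillates (\<lambda>n. {x\<in>X. b < f n x}) (\<lambda>n. {x\<in>X. f n x < a}) UNIV M"
proof (rule ccontr)
  assume contra: "\<not> ?thesis"
  define osc where "osc s a b x \<longleftrightarrow>
      infinite {n. of_rat b < f (s n) x} \<and> infinite {n. f (s n) x < of_rat a}"
    for s :: "nat \<Rightarrow> nat" and a b :: rat and x
  define calm where "calm k s \<longleftrightarrow> (case from_nat k of (a, b) \<Rightarrow> a < b \<longrightarrow> (\<forall>x\<in>X. \<not> osc s a b x))"
    for k :: nat and s :: "nat \<Rightarrow> nat"
  have osc_sub: "osc s a b x" if "strict_mono r" "osc (s \<circ> r) a b x" for s r a b x
    using that infinite_vimage_strict_mono[OF that(1)] unfolding osc_def by simp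
  interpret subseqs calm
  proof
    fix k :: nat and s :: "nat \<Rightarrow> nat" assume s: "strict_mono s"
    obtain a b :: rat where ab: "from_nat k = (a, b)" by fastforce
    show "\<exists>r'. strict_mono r' \<and> calm k (s \<circ> r')"
    proof (cases "a < b")
      case False
      then show ?thesis by (intro exI[of _ id]) (auto simp: calm_def ab strict_mono_def)
    next
      case True
      have "infinite (range s)" using s by (simp add: finite_image_iff strict_mono_imp_inj_on)
      moreover have "(of_rat a :: real) < of_rat b" using True by (simp add: of_rat_less)
      ultimately have "\<not> oscillates (\<lambda>n. {x\<in>X. of_rat b < f n x}) (\<lambda>n. {x\<in>X. f n x < of_rat a}) UNIV (range s)"
        using contra by blast
      then obtain L where L: "L \<subseteq> range s" "infinite L"
        "\<And>x. finite {n\<in>L. x \<in> X \<and> of_rat b < f n x} \<or> finite {n\<in>L. x \<in> X \<and> f n x < of_rat a}"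
        unfolding oscillates_def by auto
      define K where "K = s -` L"
      have "L = s ` K" using L(1) by (auto simp: K_def)
      then have "infinite K" using L(2) by auto
      then have r: "strict_mono (enumerate K)" "\<And>i. enumerate K i \<in> K"
        by (auto simp: strict_mono_enumerate enumerate_in_set)
      have inj: "inj (s \<circ> enumerate K)"
        by (intro strict_mono_imp_inj_on strict_mono_o s r)
      have "\<not> osc (s \<circ> enumerate K) a b x" if "x \<in> X" for x
      proof -
        have fin: "finite {n. Q ((s \<circ> enumerate K) n)}" if "finite {n\<in>L. Q n}" for Q
        proof -
          have "{n. Q ((s \<circ> enumerate K) n)} = (s \<circ> enumerate K) -` {n\<in>L. Q n}"
            using r(2) by (auto simp: K_def)
          then show ?thesis using finite_vimageI[OF that inj] by simp
        qed
        then show ?thesis 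
          using L(3)[of x] that fin[of "\<lambda>n. of_rat b < f n x"] fin[of "\<lambda>n. f n x < of_rat a"]
          unfolding osc_def by auto
      qed
      then show ?thesis using r(1) by (intro exI[of _ "enumerate K"]) (auto simp: calm_def ab)
    qed
  qed
  obtain x where x: "x \<in> X" "\<not> convergent (\<lambda>n. f (diagseq n) x)"
    using noconv[OF subseq_diagseq] by blast
  obtain a b :: rat where ab: "a < b" "osc diagseq a b x"
    using bounded_oscillation[OF bdd[OF x(1)] x(2)] unfolding osc_def by metis
  define k where "k = to_nat (a, b)"
  have "calm k (diagseq \<circ> ((+) (Suc k)))"
    by (rule diagseq_holds) (auto simp: calm_def dest: osc_sub)
  then have "\<not> osc (\<lambda>n. diagseq (Suc k + n)) a b x"
    using x(1) ab(1) by (simp add: calm_def k_def o_def)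
  moreover have "infinite {n. Q (Suc k + n)}" if "infinite {n. Q n}" for Q
  proof
    assume "finite {n. Q (Suc k + n)}"
    then have "finite ({..k} \<union> (+) (Suc k) ` {n. Q (Suc k + n)})" by blast
    moreover have "{n. Q n} \<subseteq> {..k} \<union> (+) (Suc k) ` {n. Q (Suc k + n)}"
    proof
      fix n assume "n \<in> {n. Q n}"
      then show "n \<in> {..k} \<union> (+) (Suc k) ` {n. Q (Suc k + n)}"
        by (cases "n \<le> k") (auto intro!: image_eqI[of _ _ "n - Suc k"])
    qed
    ultimately show False using that finite_subset by blast
  qed
  ultimately show False using ab(2) unfolding osc_def by blast
qed

theorem rosenthal_independence:
  fixes f :: "nat \<Rightarrow> 'x \<Rightarrow> real"
  assumes bdd: "\<And>n x. x \<in> X \<Longrightarrow> \<bar>f n x\<bar> \<le> c"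
    and noconv: "\<And>r. strict_mono (r :: nat \<Rightarrow> nat) \<Longrightarrow> \<exists>x\<in>X. \<not> convergent (\<lambda>n. f (r n) x)"
  shows "\<exists>a b (r :: nat \<Rightarrow> nat). a < b \<and> (\<forall>m I.
    \<exists>x. \<forall>i<m. x \<in> X \<and> (if i \<in> I then b < f (r i) x else f (r i) x < a))"
proof -
  obtain a b :: real and M where ab: "a < b" and M: "infinite M"
    "oscillates (\<lambda>n. {x\<in>X. b < f n x}) (\<lambda>n. {x\<in>X. f n x < a}) UNIV M"
    using ex_stable_oscillation[of X f c, OF bdd noconv] by blast
  let ?A = "\<lambda>n. {x\<in>X. b < f n x}" and ?B = "\<lambda>n. {x\<in>X. f n x < a}"
  define good where "good \<S> \<longleftrightarrow> finite \<S> \<and> (\<exists>M. infinite M \<and> (\<forall>S\<in>\<S>. oscillates ?A ?B S M))" for \<S>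
  have "\<exists>r :: nat \<Rightarrow> nat. (\<forall>k. r k \<in> UNIV) \<and>
      (\<forall>m I. (\<Inter>i<m. if i \<in> I then ?A (r i) else ?B (r i)) \<noteq> {})"
  proof (rule independent_sequence[of good UNIV ?A ?B])
    show "good {UNIV}" using M by (auto simp: good_def)
  next
    fix \<S> assume "good \<S>"
    then obtain M where M: "finite \<S>" "infinite M" "\<And>S. S \<in> \<S> \<Longrightarrow> oscillates ?A ?B S M"
      by (auto simp: good_def)
    obtain n L where "infinite L"
      "\<forall>S\<in>\<S>. oscillates ?A ?B (S \<inter> ?A n) L \<and> oscillates ?A ?B (S \<inter> ?B n) L"
      using oscillates_refine[of \<S> M ?A ?B] M by blast
    then show "\<exists>n\<in>UNIV. good (\<Union>S\<in>\<S>. {S \<inter> ?A n, S \<inter> ?B n})"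
      using M(1) by (intro bexI[of _ n]) (auto simp: good_def)
  next
    fix \<S> S assume "good \<S>" "S \<in> \<S>"
    then show "S \<noteq> {}" by (force simp: good_def oscillates_def)
  qed
  then obtain r :: "nat \<Rightarrow> nat" where
    r: "\<And>m I. (\<Inter>i<m. if i \<in> I then ?A (r i) else ?B (r i)) \<noteq> {}" by blast
  have cell: "\<exists>x. \<forall>i<m. x \<in> X \<and> (if i \<in> I then b < f (r i) x else f (r i) x < a)" for m I
  proof -
    obtain x where x: "x \<in> (\<Inter>i<m. if i \<in> I then ?A (r i) else ?B (r i))" using r by blast
    have "x \<in> X \<and> (if i \<in> I then b < f (r i) x else f (r i) x < a)" if "i < m" for i
      using INT_D[OF x, of i] that by (cases "i \<in> I") simp_all
    then have "\<forall>i<m. x \<in> X \<and> (if i \<in> I then b < f (r i) x else f (r i) x < a)"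
      by simp
    then show ?thesis by (rule exI)
  qed
  show ?thesis
    by (rule exI[of _ a], rule exI[of _ b], rule exI[of _ r], rule conjI[OF ab],
        rule allI, rule allI, rule cell)
qed

text \<open>
  Test a linear combination on the difference of two vectors in the unit ball that realize the sign
  pattern of its coefficients and the opposite pattern: each coefficient then contributes at least
  \<open>b - a\<close> times its absolute value.
\<close>

theorem rosenthal_ell1:
  fixes y :: "nat \<Rightarrow> 'a::real_normed_vector \<Rightarrow>\<^sub>L real"
  assumes bdd: "\<And>n. norm (y n) \<le> 1"
    and noconv: "\<And>r. strict_mono (r :: nat \<Rightarrow> nat) \<Longrightarrow> \<exists>x. \<not> convergent (\<lambda>n. blinfun_apply (y (r n)) x)"
  shows "\<exists>c>0. \<exists>r :: nat \<Rightarrow> nat. \<forall>F a. finite F \<longrightarrow>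
    c * (\<Sum>i\<in>F. \<bar>a i\<bar>) \<le> norm (\<Sum>i\<in>F. a i *\<^sub>R y (r i))"
proof -
  let ?X = "cball 0 1 :: 'a set"
  have "\<bar>blinfun_apply (y n) x\<bar> \<le> 1" if "x \<in> ?X" for n x
    using norm_blinfun[of "y n" x] mult_mono[OF bdd[of n], of "norm x" 1] that by simp
  moreover have "\<exists>x\<in>?X. \<not> convergent (\<lambda>n. blinfun_apply (y (r n)) x)" if "strict_mono r" for r
  proof -
    obtain x where x: "\<not> convergent (\<lambda>n. blinfun_apply (y (r n)) x)" using noconv[OF \<open>strict_mono r\<close>] by blast
    have "x \<noteq> 0" using x by (auto simp: convergent_const)
    then have "\<not> convergent (\<lambda>n. blinfun_apply (y (r n)) ((1 / norm x) *\<^sub>R x))"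
      using x convergent_mult_const_iff[of "1 / norm x" "\<lambda>n. blinfun_apply (y (r n)) x"]
      by (simp add: blinfun.scaleR_right)
    then show ?thesis using \<open>x \<noteq> 0\<close> by (intro bexI[of _ "(1 / norm x) *\<^sub>R x"]) auto
  qed
  ultimately obtain a b :: real and r :: "nat \<Rightarrow> nat" where ab: "a < b"
    and r: "\<And>m I. \<exists>x. \<forall>i<m. x \<in> ?X \<and> (if i \<in> I then b < blinfun_apply (y (r i)) x else blinfun_apply (y (r i)) x < a)"
    using rosenthal_independence[of ?X "\<lambda>n. blinfun_apply (y n)" 1] by blast
  have "(b - a) / 2 * (\<Sum>i\<in>F. \<bar>t i\<bar>) \<le> norm (\<Sum>i\<in>F. t i *\<^sub>R y (r i))" if F: "finite F" for F t
  proof -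
    let ?v = "\<Sum>i\<in>F. t i *\<^sub>R y (r i)"
    obtain m where m: "F \<subseteq> {..<Suc m}"
      using finite_nat_bounded[OF F] by (metis lessThan_Suc_atMost lessThan_subset_iff le_Suc_eq order_refl subset_trans)
    obtain u where u: "\<forall>i<Suc m. u \<in> ?X \<and> (if i \<in> {i. 0 < t i} then b < blinfun_apply (y (r i)) u else blinfun_apply (y (r i)) u < a)"
      using r by blast
    obtain w where w: "\<forall>i<Suc m. w \<in> ?X \<and> (if i \<in> - {i. 0 < t i} then b < blinfun_apply (y (r i)) w else blinfun_apply (y (r i)) w < a)"
      using r by blast
    have uw: "norm u \<le> 1" "norm w \<le> 1" using u w by auto
    have "(b - a) * (\<Sum>i\<in>F. \<bar>t i\<bar>) = (\<Sum>i\<in>F. (b - a) * \<bar>t i\<bar>)"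
      by (simp add: sum_distrib_left)
    also have "\<dots> \<le> (\<Sum>i\<in>F. t i * blinfun_apply (y (r i)) (u - w))"
    proof (rule sum_mono)
      fix i assume "i \<in> F"
      then have i: "i < Suc m" using m by auto
      show "(b - a) * \<bar>t i\<bar> \<le> t i * blinfun_apply (y (r i)) (u - w)"
      proof (cases "0 < t i")
        case True
        then have "b - a \<le> blinfun_apply (y (r i)) (u - w)"
          using u[rule_format, OF i] w[rule_format, OF i] by (simp add: blinfun.diff_right)
        then show ?thesis using True mult_left_mono[of "b - a" "blinfun_apply (y (r i)) (u - w)" "t i"]
            by (simp add: mult.commute)
      next
        case False
        then have "b - a \<le> - blinfun_apply (y (r i)) (u - w)"
          using u[rule_format, OF i] w[rule_format, OF i] by (simp add: blinfun.diff_right)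
        then show ?thesis using False mult_left_mono[of "b - a" "- blinfun_apply (y (r i)) (u - w)" "- t i"]
            by (simp add: mult.commute)
      qed
    qed
    also have "\<dots> = blinfun_apply ?v (u - w)"
      by (simp add: blinfun.sum_left blinfun.scaleR_left)
    also have "\<dots> \<le> norm ?v * norm (u - w)" using norm_blinfun[of ?v "u - w"] by simp
    also have "\<dots> \<le> norm ?v * 2"
      using norm_triangle_ineq4[of u w] uw by (intro mult_left_mono) auto
    finally show ?thesis by simp
  qed
  with ab show ?thesis
    by (intro exI[of _ "(b - a) / 2"] conjI exI[of _ r] allI impI) auto
qed

section \<open>Asymptotic norms of sequences of functionals\<close>

text \<open>
  The ordering principle of Brezis and Browder: descend so that step \<open>n\<close> comes within
  \<open>1 / Suc n\<close> of the infimum of \<open>\<phi>\<close> over all elements below the current one. A lower bound of this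
  sequence cannot be improved.
\<close>

lemma ex_stable_element:
  fixes R :: "'s \<Rightarrow> 's \<Rightarrow> bool" and \<phi> :: "'s \<Rightarrow> real"
  assumes "w0 \<in> C"
    and refl: "\<And>w. R w w"
    and trans: "\<And>u v w. R u v \<Longrightarrow> R v w \<Longrightarrow> R u w"
    and mono: "\<And>v w. v \<in> C \<Longrightarrow> w \<in> C \<Longrightarrow> R v w \<Longrightarrow> \<phi> v \<le> \<phi> w"
    and nonneg: "\<And>w. w \<in> C \<Longrightarrow> 0 \<le> \<phi> w"
    and lower: "\<And>s :: nat \<Rightarrow> 's. (\<And>n. s n \<in> C) \<Longrightarrow> (\<And>n. R (s (Suc n)) (s n)) \<Longrightarrow>
                  \<exists>w\<in>C. \<forall>n. R w (s n)"
  shows "\<exists>w\<in>C. \<forall>v\<in>C. R v w \<longrightarrow> \<phi> v = \<phi> w"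
proof -
  define low where "low w = Inf (\<phi> ` {v\<in>C. R v w})" for w
  have low_le: "low w \<le> \<phi> v" if "v \<in> C" "R v w" for v w
    unfolding low_def using that nonneg by (intro cInf_lower) (auto intro!: bdd_belowI)
  have ex: "\<exists>v\<in>C. R v w \<and> \<phi> v < low w + 1 / real (Suc n)" if "w \<in> C" for w n
  proof -
    have "\<phi> ` {v\<in>C. R v w} \<noteq> {}" using that refl by blast
    then obtain t where "t \<in> \<phi> ` {v\<in>C. R v w}" "t < low w + 1 / real (Suc n)"
      using cInf_lessD[of "\<phi> ` {v\<in>C. R v w}" "low w + 1 / real (Suc n)"]
      by (auto simp: low_def)
    then show ?thesis by blast
  qed
  have "\<exists>s. \<forall>n. s n \<in> C \<and> (R (s (Suc n)) (s n) \<and> \<phi> (s (Suc n)) < low (s n) + 1 / real (Suc n))"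
    by (rule dependent_nat_choice) (use \<open>w0 \<in> C\<close> ex in auto)
  then obtain s where s: "\<And>n. s n \<in> C" "\<And>n. R (s (Suc n)) (s n)"
    "\<And>n. \<phi> (s (Suc n)) < low (s n) + 1 / real (Suc n)" by blast
  obtain w where w: "w \<in> C" "\<And>n. R w (s n)" using lower[of s, OF s(1,2)] by blast
  have "\<phi> v = \<phi> w" if v: "v \<in> C" "R v w" for v
  proof (rule antisym)
    show "\<phi> v \<le> \<phi> w" using v w(1) mono by blast
    have le: "\<phi> w \<le> \<phi> v + 1 / real (Suc n)" for n
      using mono[OF w(1) s(1) w(2)[of "Suc n"]] s(3)[of n] low_le[OF v(1) trans[OF v(2) w(2)[of n]]]
      by linarith
    have "(\<lambda>n. \<phi> v + 1 / real (Suc n)) \<longlonglongrightarrow> \<phi> v + 0"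
      by (intro tendsto_add tendsto_const LIMSEQ_inverse_real_of_nat[unfolded inverse_eq_divide])
    then show "\<phi> w \<le> \<phi> v" using le by (intro LIMSEQ_le_const) auto
  qed
  then show ?thesis using w(1) by blast
qed

definition exceeds :: "(nat \<Rightarrow> 'a::real_normed_vector \<Rightarrow>\<^sub>L real) \<Rightarrow> real \<Rightarrow> bool" where
  "exceeds w t \<longleftrightarrow> (\<exists>x\<in>cball 0 1. infinite {k. t < \<bar>blinfun_apply (w k) x\<bar>})"

text \<open>
  The supremum over the unit ball of \<open>limsup \<bar>w k x\<bar>\<close>, for sequences in the dual unit ball.
\<close>

definition asymptotic_norm :: "(nat \<Rightarrow> 'a::real_normed_vector \<Rightarrow>\<^sub>L real) \<Rightarrow> real" where
  "asymptotic_norm w = Sup {t. exceeds w t}"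

lemma blinfun_le_1:
  assumes "norm f \<le> 1" "x \<in> cball 0 1"
  shows "\<bar>blinfun_apply f x :: real\<bar> \<le> 1"
  using norm_blinfun[of f x] mult_mono[OF assms(1), of "norm x" 1] assms(2) by simp

lemma
  assumes le: "\<And>k. norm (w k) \<le> 1"
  shows exceeds_less_1: "exceeds w t \<Longrightarrow> t < 1"
    and exceeds_neg: "t < 0 \<Longrightarrow> exceeds w t"
    and asymptotic_norm_nonneg: "0 \<le> asymptotic_norm w"
    and exceeds_if_less: "t < asymptotic_norm w \<Longrightarrow> exceeds w t"
    and not_exceeds_if_greater: "asymptotic_norm w < t \<Longrightarrow> \<not> exceeds w t"
proof -
  show lt: "t < 1" if "exceeds w t" for t
  proof -
    obtain x where x: "x \<in> cball 0 1" "infinite {k. t < \<bar>blinfun_apply (w k) x\<bar>}"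
      using \<open>exceeds w t\<close> unfolding exceeds_def by blast
    obtain k where "t < \<bar>blinfun_apply (w k) x\<bar>" using infinite_imp_nonempty[OF x(2)] by blast
    then show ?thesis using blinfun_le_1[OF le x(1), of k] by simp
  qed
  show neg: "exceeds w t" if "t < 0" for t
    unfolding exceeds_def using that by (intro bexI[of _ 0]) auto
  have bdd: "bdd_above {t. exceeds w t}" using lt by (auto intro!: bdd_aboveI[of _ 1] less_imp_le)
  have up: "t \<le> asymptotic_norm w" if "exceeds w t" for t
    unfolding asymptotic_norm_def using bdd that by (intro cSup_upper) auto
  show "0 \<le> asymptotic_norm w"
    by (rule dense_le) (use neg up in blast)
  show "\<not> exceeds w t" if "asymptotic_norm w < t" using up that by force
  show "exceeds w t" if "t < asymptotic_norm w"
  proof -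
    have "{t. exceeds w t} \<noteq> {}" using neg[of "-1"] by auto
    then obtain s where "exceeds w s" "t < s"
      using less_cSupD[of "{t. exceeds w t}" t] \<open>t < asymptotic_norm w\<close> by (auto simp: asymptotic_norm_def)
    then obtain x where x: "x \<in> cball 0 1" "infinite {k. s < \<bar>blinfun_apply (w k) x\<bar>}"
      unfolding exceeds_def by blast
    have "infinite {k. t < \<bar>blinfun_apply (w k) x\<bar>}"
      using \<open>t < s\<close> by (intro infinite_super[OF _ x(2)]) auto
    then show ?thesis using x(1) by (auto simp: exceeds_def)
  qed
qed

text \<open>
  In polar form: eventually, \<open>w k\<close> lies in the weak-star closed absolutely convex hull of the
  \<open>z j\<close> with \<open>j \<ge> k\<close>.
\<close>

definition tail_dominated ::
    "(nat \<Rightarrow> 'a::real_normed_vector \<Rightarrow>\<^sub>L real) \<Rightarrow> (nat \<Rightarrow> 'a \<Rightarrow>\<^sub>L real) \<Rightarrow> bool" where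
  "tail_dominated w z \<longleftrightarrow> (\<exists>m. \<forall>k\<ge>m. \<forall>x t.
     (\<forall>j\<ge>k. \<bar>blinfun_apply (z j) x\<bar> \<le> t) \<longrightarrow> \<bar>blinfun_apply (w k) x\<bar> \<le> t)"

lemma tail_dominated_refl: "tail_dominated w w"
  by (auto simp: tail_dominated_def)

lemma tail_dominated_trans:
  assumes "tail_dominated u v" "tail_dominated v w"
  shows "tail_dominated u w"
proof -
  obtain m where m: "\<And>k x t. k \<ge> m \<Longrightarrow> (\<forall>j\<ge>k. \<bar>blinfun_apply (v j) x\<bar> \<le> t) \<Longrightarrow> \<bar>blinfun_apply (u k) x\<bar> \<le> t"
    using assms(1) unfolding tail_dominated_def by blast
  obtain m' where m': "\<And>k x t. k \<ge> m' \<Longrightarrow> (\<forall>j\<ge>k. \<bar>blinfun_apply (w j) x\<bar> \<le> t) \<Longrightarrow> \<bar>blinfun_apply (v k) x\<bar> \<le> t"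
    using assms(2) unfolding tail_dominated_def by blast
  show ?thesis
    unfolding tail_dominated_def
  proof (intro exI[of _ "max m m'"] allI impI)
    fix k x t assume "max m m' \<le> k" and t: "\<forall>j\<ge>k. \<bar>blinfun_apply (w j) x\<bar> \<le> t"
    then have "\<forall>j\<ge>k. \<bar>blinfun_apply (v j) x\<bar> \<le> t" by (auto intro!: m')
    then show "\<bar>blinfun_apply (u k) x\<bar> \<le> t" using \<open>max m m' \<le> k\<close> by (intro m) auto
  qed
qed

lemma tail_dominated_exceeds:
  assumes "tail_dominated w z" "exceeds w t"
  shows "exceeds z t"
proof -
  obtain m where m: "\<And>k x t. k \<ge> m \<Longrightarrow> (\<forall>j\<ge>k. \<bar>blinfun_apply (z j) x\<bar> \<le> t) \<Longrightarrow> \<bar>blinfun_apply (w k) x\<bar> \<le> t"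
    using assms(1) unfolding tail_dominated_def by blast
  obtain x where x: "x \<in> cball 0 1" "infinite {k. t < \<bar>blinfun_apply (w k) x\<bar>}"
    using assms(2) unfolding exceeds_def by blast
  have "\<exists>n\<ge>N. t < \<bar>blinfun_apply (z n) x\<bar>" for N
  proof -
    obtain k where "k \<ge> max m N" "t < \<bar>blinfun_apply (w k) x\<bar>"
      using x(2) unfolding infinite_nat_iff_unbounded_le by blast
    then show ?thesis using m[of k x t] by (meson leD max.boundedE not_le order_trans)
  qed
  then have "infinite {k. t < \<bar>blinfun_apply (z k) x\<bar>}"
    by (auto simp: infinite_nat_iff_unbounded_le)
  then show ?thesis using x(1) by (auto simp: exceeds_def)
qed

lemma asymptotic_norm_mono:
  assumes "tail_dominated w z" "\<And>k. norm (w k) \<le> 1" "\<And>k. norm (z k) \<le> 1"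
  shows "asymptotic_norm w \<le> asymptotic_norm z"
proof (rule dense_le)
  fix t assume "t < asymptotic_norm w"
  then have "exceeds z t"
    using tail_dominated_exceeds[OF assms(1)] exceeds_if_less[of w, OF assms(2)] by blast
  then show "t \<le> asymptotic_norm z"
    using not_exceeds_if_greater[of z, OF assms(3)] by force
qed

lemma asymptotic_norm_zero:
  assumes "\<And>k. norm (w k) \<le> 1" "asymptotic_norm w = 0"
  shows "(\<lambda>k. blinfun_apply (w k) x) \<longlonglongrightarrow> 0"
proof -
  have ball: "(\<lambda>k. blinfun_apply (w k) x) \<longlonglongrightarrow> 0" if x: "x \<in> cball 0 1" for x
  proof (rule LIMSEQ_I)
    fix e :: real assume e: "0 < e"
    then have "\<not> exceeds w (e / 2)" using not_exceeds_if_greater[of w, OF assms(1)] assms(2) by simp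
    then have "finite {k. e / 2 < \<bar>blinfun_apply (w k) x\<bar>}" using x by (auto simp: exceeds_def)
    then obtain N where "\<And>k. e / 2 < \<bar>blinfun_apply (w k) x\<bar> \<Longrightarrow> k < N"
      by (auto simp: finite_nat_set_iff_bounded)
    then have "\<forall>n\<ge>N. \<bar>blinfun_apply (w n) x\<bar> \<le> e / 2" by (meson leD not_le)
    then show "\<exists>no. \<forall>n\<ge>no. norm (blinfun_apply (w n) x - 0) < e"
      using e by (intro exI[of _ N]) fastforce
  qed
  show ?thesis
  proof (cases "x = 0")
    case False
    have "(\<lambda>k. norm x * blinfun_apply (w k) ((1 / norm x) *\<^sub>R x)) \<longlonglongrightarrow> norm x * 0"
      using False by (intro tendsto_mult tendsto_const ball) simp
    then show ?thesis using False by (simp add: blinfun.scaleR_right)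
  qed simp
qed

text \<open>
  The domination of \<open>s (Suc n)\<close> by \<open>s n\<close> starts only at an index \<open>m n\<close>. So the \<open>k\<close>-th diagonal term
  is taken at a position \<open>p k\<close> beyond \<open>m 0, \<dots>, m k\<close>, where the whole chain down to each earlier
  sequence is available.
\<close>

lemma tail_dominated_diagonal:
  fixes s :: "nat \<Rightarrow> nat \<Rightarrow> 'a::real_normed_vector \<Rightarrow>\<^sub>L real"
  assumes "\<And>n. tail_dominated (s (Suc n)) (s n)"
  obtains p :: "nat \<Rightarrow> nat" where "\<And>k. k \<le> p k" "\<And>n. tail_dominated (\<lambda>k. s k (p k)) (s n)"
proof -
  have "\<forall>n. \<exists>m. \<forall>k\<ge>m. \<forall>x t. (\<forall>j\<ge>k. \<bar>blinfun_apply (s n j) x\<bar> \<le> t) \<longrightarrow> \<bar>blinfun_apply (s (Suc n) k) x\<bar> \<le> t"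
    using assms by (simp add: tail_dominated_def)
  then obtain m where m: "\<And>n k x t. k \<ge> m n \<Longrightarrow> (\<forall>j\<ge>k. \<bar>blinfun_apply (s n j) x\<bar> \<le> t) \<Longrightarrow> \<bar>blinfun_apply (s (Suc n) k) x\<bar> \<le> t"
    by metis
  have chain: "\<bar>blinfun_apply (s (n + d) k) x\<bar> \<le> t"
    if "\<forall>i<n + d. m i \<le> k" "\<forall>j\<ge>k. \<bar>blinfun_apply (s n j) x\<bar> \<le> t" for n d k x t
    using that
  proof (induction d arbitrary: k)
    case (Suc d)
    have "\<bar>blinfun_apply (s (n + d) j) x\<bar> \<le> t" if "j \<ge> k" for j
      
    proof (intro Suc.IH)
      show "\<forall>i<n + d. m i \<le> j" using Suc.prems(1) that by (metis add_Suc_right less_SucI order_trans)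
      show "\<forall>i\<ge>j. \<bar>blinfun_apply (s n i) x\<bar> \<le> t" using Suc.prems(2) that by auto
    qed
    then show ?case using m[of "n + d" k x t] Suc.prems(1) by simp
  qed simp
  define p where "p k = k + (\<Sum>i\<le>k. m i)" for k
  have pm: "m i \<le> p k" if "i \<le> k" for i k
    using member_le_sum[of i "{..k}" m] that by (simp add: p_def)
  have "tail_dominated (\<lambda>k. s k (p k)) (s n)" for n
    unfolding tail_dominated_def
  proof (intro exI[of _ n] allI impI)
    fix k x t assume "n \<le> k" and t: "\<forall>j\<ge>k. \<bar>blinfun_apply (s n j) x\<bar> \<le> t"
    have "\<forall>j\<ge>p k. \<bar>blinfun_apply (s n j) x\<bar> \<le> t" using t by (simp add: p_def)
    then show "\<bar>blinfun_apply (s k (p k)) x\<bar> \<le> t"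
      using chain[of n "k - n" "p k" x t] \<open>n \<le> k\<close> pm by simp
  qed
  then show ?thesis by (intro that[of p]) (auto simp: p_def)
qed

section \<open>Stable blocks of an \<open>\<ell>\<^sub>1\<close>-sequence\<close>

locale ell1_functionals =
  fixes y :: "nat \<Rightarrow> 'a::real_normed_vector \<Rightarrow>\<^sub>L real" and c :: real
  assumes norm_le: "norm (y n) \<le> 1" and c_pos: "c > 0"
    and norm_ge: "finite F \<Longrightarrow> c * (\<Sum>i\<in>F. \<bar>a i\<bar>) \<le> norm (\<Sum>i\<in>F. a i *\<^sub>R y i)"
begin

text \<open>
  Combinations with coefficients of total mass exactly \<open>r\<close>. The lower bound \<open>c * r\<close> for their norms
  would be lost by cancellation if supports overlapped, so blocks are only added when one lies to the
  left of the other.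
\<close>

definition blocks :: "nat \<Rightarrow> nat \<Rightarrow> real \<Rightarrow> ('a \<Rightarrow>\<^sub>L real) set" where
  "blocks n m r = {\<Sum>i=n..<m. a i *\<^sub>R y i | a. n \<le> m \<and> (\<Sum>i=n..<m. \<bar>a i\<bar>) = r}"

lemma blocks_le: "v \<in> blocks n m r \<Longrightarrow> n \<le> m"
  by (auto simp: blocks_def)

lemma blocks_add:
  assumes "u \<in> blocks n m r" "v \<in> blocks m l s"
  shows "u + v \<in> blocks n l (r + s)"
proof -
  obtain a where a: "u = (\<Sum>i=n..<m. a i *\<^sub>R y i)" "n \<le> m" "(\<Sum>i=n..<m. \<bar>a i\<bar>) = r"
    using assms(1) by (auto simp: blocks_def)
  obtain b where b: "v = (\<Sum>i=m..<l. b i *\<^sub>R y i)" "m \<le> l" "(\<Sum>i=m..<l. \<bar>b i\<bar>) = s"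
    using assms(2) by (auto simp: blocks_def)
  let ?e = "\<lambda>i. if i < m then a i else b i"
  have "(\<Sum>i=n..<l. ?e i *\<^sub>R y i) = u + v" "(\<Sum>i=n..<l. \<bar>?e i\<bar>) = r + s"
    unfolding a(1) b(1) a(3)[symmetric] b(3)[symmetric]
      sum.atLeastLessThan_concat[OF a(2) b(2), symmetric]
    by (auto intro!: arg_cong2[where f = "(+)"] sum.cong)
  then show ?thesis using a(2) b(2) unfolding blocks_def by (auto intro!: exI[of _ ?e])
qed

lemma zero_in_blocks: "n \<le> m \<Longrightarrow> 0 \<in> blocks n m 0"
  by (auto simp: blocks_def intro!: exI[of _ "\<lambda>_. 0"])

lemma blocks_mono: "v \<in> blocks m l r \<Longrightarrow> n \<le> m \<Longrightarrow> v \<in> blocks n l r"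
  using blocks_add[OF zero_in_blocks, of n m v l r] by simp

lemma blocks_scale:
  assumes "v \<in> blocks n m r" shows "t *\<^sub>R v \<in> blocks n m (\<bar>t\<bar> * r)"
proof -
  obtain a where a: "v = (\<Sum>i=n..<m. a i *\<^sub>R y i)" "n \<le> m" "(\<Sum>i=n..<m. \<bar>a i\<bar>) = r"
    using assms by (auto simp: blocks_def)
  have "t *\<^sub>R v = (\<Sum>i=n..<m. (t * a i) *\<^sub>R y i)" "(\<Sum>i=n..<m. \<bar>t * a i\<bar>) = \<bar>t\<bar> * r"
    unfolding a(1) a(3)[symmetric] by (simp_all add: scaleR_sum_right sum_distrib_left abs_mult)
  then show ?thesis
    using a(2) unfolding blocks_def mem_Collect_eq by (intro exI[of _ "\<lambda>i. t * a i"]) simp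
qed

lemma blocks_norm_le: "v \<in> blocks n m r \<Longrightarrow> norm v \<le> r"
  by (auto simp: blocks_def intro!: sum_norm_le mult_left_le norm_le)

lemma blocks_norm_ge: "v \<in> blocks n m r \<Longrightarrow> c * r \<le> norm v"
  by (auto simp: blocks_def norm_ge)

text \<open>
  Block sequences are not required to have successive supports; supports only move to infinity. So
  diagonal sequences are again block sequences, and blocks with successive supports can be chosen
  when they are needed.
\<close>

definition block_sequences :: "(nat \<Rightarrow> 'a \<Rightarrow>\<^sub>L real) set" where
  "block_sequences = {w. \<forall>k. \<exists>m. w k \<in> blocks k m 1}"

lemma block_sequences_norm_le: "w \<in> block_sequences \<Longrightarrow> norm (w k) \<le> 1"
  using blocks_norm_le by (force simp: block_sequences_def)

lemma block_sequences_norm_ge: "w \<in> block_sequences \<Longrightarrow> c \<le> norm (w k)"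
  using blocks_norm_ge by (force simp: block_sequences_def)

definition stable :: "(nat \<Rightarrow> 'a \<Rightarrow>\<^sub>L real) \<Rightarrow> bool" where
  "stable z \<longleftrightarrow> z \<in> block_sequences \<and> (\<forall>w\<in>block_sequences. tail_dominated w z \<longrightarrow>
     asymptotic_norm w = asymptotic_norm z)"

lemma ex_stable: "\<exists>z. stable z"
proof -
  have "y k \<in> blocks k (Suc k) 1" for k
    unfolding blocks_def by (auto intro!: exI[of _ "\<lambda>_. 1"])
  then have y: "y \<in> block_sequences" by (auto simp: block_sequences_def)
  have "\<exists>z\<in>block_sequences. \<forall>w\<in>block_sequences. tail_dominated w z \<longrightarrow>
      asymptotic_norm w = asymptotic_norm z"
  proof (rule ex_stable_element[OF y])
    fix s :: "nat \<Rightarrow> nat \<Rightarrow> 'a \<Rightarrow>\<^sub>L real"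
    assume s: "\<And>n. s n \<in> block_sequences" "\<And>n. tail_dominated (s (Suc n)) (s n)"
    obtain p where p: "\<And>k. k \<le> p k" "\<And>n. tail_dominated (\<lambda>k. s k (p k)) (s n)"
      using tail_dominated_diagonal[of s, OF s(2)] by metis
    have "(\<lambda>k. s k (p k)) \<in> block_sequences"
      using s(1) p(1) blocks_mono by (simp add: block_sequences_def) metis
    then show "\<exists>w\<in>block_sequences. \<forall>n. tail_dominated w (s n)" using p(2) by blast
  qed (auto intro: tail_dominated_refl tail_dominated_trans asymptotic_norm_mono
      asymptotic_norm_nonneg block_sequences_norm_le)
  then show ?thesis by (auto simp: stable_def)
qed

text \<open>
  The indices are chosen one after another, each beyond the support of the sum formed so far.
\<close>

lemma ex_signed_block:
  assumes z: "z \<in> block_sequences" and N: "\<And>i. i < l \<Longrightarrow> infinite (N i)"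
    and \<sigma>: "\<And>i. i < l \<Longrightarrow> \<bar>\<sigma> i\<bar> = 1"
  shows "\<exists>j m. (\<forall>i<l. j i \<in> N i \<and> k \<le> j i) \<and>
    (\<Sum>i<l. \<sigma> i *\<^sub>R z (j i)) \<in> blocks k m (real l)"
  using N \<sigma>
proof (induction l)
  case 0
  show ?case using zero_in_blocks[of k k] by auto
next
  case (Suc l)
  have "\<exists>j m. (\<forall>i<l. j i \<in> N i \<and> k \<le> j i) \<and> (\<Sum>i<l. \<sigma> i *\<^sub>R z (j i)) \<in> blocks k m (real l)"
    using Suc.prems by (intro Suc.IH) auto
  then obtain j m where j: "\<forall>i<l. j i \<in> N i \<and> k \<le> j i"
    "(\<Sum>i<l. \<sigma> i *\<^sub>R z (j i)) \<in> blocks k m (real l)" by blast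
  obtain n where n: "n \<in> N l" "m \<le> n"
    using Suc.prems(1)[of l] unfolding infinite_nat_iff_unbounded_le by auto
  obtain m' where "z n \<in> blocks n m' 1" using z by (auto simp: block_sequences_def)
  then have "\<sigma> l *\<^sub>R z n \<in> blocks m m' 1"
    using blocks_mono[OF blocks_scale[of "z n" n m' 1 "\<sigma> l"] n(2)] Suc.prems(2)[of l] by simp
  from blocks_add[OF j(2) this]
  have "(\<Sum>i<Suc l. \<sigma> i *\<^sub>R z ((j(l := n)) i)) \<in> blocks k m' (real (Suc l))"
    by (simp add: algebra_simps)
  moreover have "\<forall>i<Suc l. (j(l := n)) i \<in> N i \<and> k \<le> (j(l := n)) i"
    using j(1) n blocks_le[OF j(2)] by (auto simp: less_Suc_eq)
  ultimately show ?case by blast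
qed

text \<open>
  Average \<open>l\<close> signed terms of \<open>z\<close>, two from each set and with opposite signs. By stability there is a
  vector \<open>x\<close> in the unit ball where such averages exceed \<open>d - \<eta>\<close> infinitely often, whereas the terms
  themselves are eventually at most \<open>d + \<eta>\<close> in absolute value. An average that close to the upper
  bound of its terms forces each signed term to be at least \<open>d - 2 * l * \<eta> = d / 2\<close>.
\<close>

lemma ex_splitting_vector:
  assumes z: "stable z" and d: "d = asymptotic_norm z" "d > 0"
    and fin: "finite \<N>" and inf: "\<And>N. N \<in> \<N> \<Longrightarrow> infinite N"
  shows "\<exists>x\<in>cball 0 1. \<forall>N\<in>\<N>. infinite (N \<inter> {j. d / 2 \<le> blinfun_apply (z j) x}) \<and>
    infinite (N \<inter> {j. blinfun_apply (z j) x \<le> - (d / 2)})"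
proof (cases "\<N> = {}")
  case False
  have zb: "z \<in> block_sequences" using z by (simp add: stable_def)
  note z_le = block_sequences_norm_le[OF zb]
  obtain g where g: "bij_betw g {0..<card \<N>} \<N>" using ex_bij_betw_nat_finite[OF fin] by blast
  define l where "l = 2 * card \<N>"
  have l: "l > 0" using False fin by (simp add: l_def card_gt_0_iff)
  define \<sigma> where "\<sigma> i = (if even i then 1 else - 1 :: real)" for i :: nat
  have "infinite (g (i div 2))" if "i < l" for i
    using that by (intro inf bij_betw_apply[OF g]) (auto simp: l_def)
  then have "\<forall>k. \<exists>j m. (\<forall>i<l. j i \<in> g (i div 2) \<and> k \<le> j i) \<and>
      (\<Sum>i<l. \<sigma> i *\<^sub>R z (j i)) \<in> blocks k m (real l)"
    by (intro allI ex_signed_block[OF zb]) (auto simp: \<sigma>_def)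
  then obtain j m where j: "\<And>k i. i < l \<Longrightarrow> j k i \<in> g (i div 2)" "\<And>k i. i < l \<Longrightarrow> k \<le> j k i"
    "\<And>k. (\<Sum>i<l. \<sigma> i *\<^sub>R z (j k i)) \<in> blocks k (m k) (real l)" by metis
  define w where "w k = (1 / real l) *\<^sub>R (\<Sum>i<l. \<sigma> i *\<^sub>R z (j k i))" for k
  have w_apply: "blinfun_apply (w k) x = (\<Sum>i<l. \<sigma> i * blinfun_apply (z (j k i)) x) / l" for k x
    by (simp add: w_def blinfun.scaleR_left blinfun.sum_left)
  have "w k \<in> blocks k (m k) 1" for k
    using blocks_scale[OF j(3), of "1 / real l" k] l by (simp add: w_def)
  then have wb: "w \<in> block_sequences" by (auto simp: block_sequences_def)
  have "tail_dominated w z"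
    unfolding tail_dominated_def
  proof (intro exI[of _ 0] allI impI)
    fix k x t assume t: "\<forall>j\<ge>k. \<bar>blinfun_apply (z j) x\<bar> \<le> t"
    have "\<bar>\<Sum>i<l. \<sigma> i * blinfun_apply (z (j k i)) x\<bar> \<le> (\<Sum>i<l. \<bar>\<sigma> i * blinfun_apply (z (j k i)) x\<bar>)"
      by (rule sum_abs)
    also have "\<dots> \<le> (\<Sum>i<l. t)"
      using t j(2) by (intro sum_mono) (auto simp: \<sigma>_def abs_mult)
    finally show "\<bar>blinfun_apply (w k) x\<bar> \<le> t"
      using l by (simp add: w_apply abs_divide field_simps)
  qed
  then have w_norm: "asymptotic_norm w = d" using z wb d(1) by (simp add: stable_def)
  define \<eta> where "\<eta> = d / (4 * real l)"
  have \<eta>: "\<eta> > 0" "2 * real l * \<eta> = d / 2" using d(2) l by (auto simp: \<eta>_def)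
  have "exceeds w (d - \<eta>)"
    using exceeds_if_less[of w, OF block_sequences_norm_le[OF wb]] w_norm \<eta>(1) by simp
  then obtain x0 where x0: "x0 \<in> cball 0 1" "infinite {k. d - \<eta> < \<bar>blinfun_apply (w k) x0\<bar>}"
    unfolding exceeds_def by blast
  have "{k. d - \<eta> < \<bar>blinfun_apply (w k) x0\<bar>} \<subseteq>
      {k. d - \<eta> < blinfun_apply (w k) x0} \<union> {k. d - \<eta> < blinfun_apply (w k) (- x0)}"
    by (auto simp: blinfun.minus_right abs_if split: if_splits)
  then have "infinite {k. d - \<eta> < blinfun_apply (w k) x0} \<or> infinite {k. d - \<eta> < blinfun_apply (w k) (- x0)}"
    using x0(2) by (meson finite_Un finite_subset)
  then obtain x where x: "x \<in> cball 0 1" "infinite {k. d - \<eta> < blinfun_apply (w k) x}"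
    using x0(1) by (metis dist_0_norm mem_cball norm_minus_cancel)
  have "\<not> exceeds z (d + \<eta>)"
    using not_exceeds_if_greater[of z, OF z_le] d(1) \<eta>(1) by simp
  then have "finite {k. d + \<eta> < \<bar>blinfun_apply (z k) x\<bar>}" using x(1) by (auto simp: exceeds_def)
  then obtain K where "\<And>k. d + \<eta> < \<bar>blinfun_apply (z k) x\<bar> \<Longrightarrow> k < K"
    by (auto simp: finite_nat_set_iff_bounded)
  then have K: "\<bar>blinfun_apply (z k) x\<bar> \<le> d + \<eta>" if "k \<ge> K" for k using that by (meson leD not_le)
  have big: "d / 2 \<le> \<sigma> i * blinfun_apply (z (j k i)) x"
    if k: "k \<ge> K" "d - \<eta> < blinfun_apply (w k) x" and i: "i < l" for k i
  proof -
    let ?f = "\<lambda>i. \<sigma> i * blinfun_apply (z (j k i)) x"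
    have "?f i' \<le> d + \<eta>" if "i' < l" for i'
      using K[of "j k i'"] j(2)[OF that, of k] k(1) by (auto simp: \<sigma>_def abs_le_iff)
    then have "sum ?f ({..<l} - {i}) \<le> of_nat (card ({..<l} - {i})) * (d + \<eta>)"
      by (intro sum_bounded_above) auto
    moreover have "sum ?f {..<l} = ?f i + sum ?f ({..<l} - {i})"
      using i by (intro sum.remove) auto
    moreover have "real l * (d - \<eta>) < sum ?f {..<l}"
      using k(2) l by (simp add: w_apply field_simps)
    moreover have "real (card ({..<l} - {i})) = real l - 1" using i l by simp
    ultimately have "real l * (d - \<eta>) < ?f i + (real l - 1) * (d + \<eta>)" by simp
    then have "d - 2 * real l * \<eta> + \<eta> < ?f i" by (simp add: algebra_simps)
    then show ?thesis using \<eta> by simp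
  qed
  have inf_N: "infinite (g (i div 2) \<inter> {j. d / 2 \<le> \<sigma> i * blinfun_apply (z j) x})" if i: "i < l" for i
    unfolding infinite_nat_iff_unbounded_le
  proof
    fix N
    obtain k where "k \<ge> max N K" "d - \<eta> < blinfun_apply (w k) x"
      using x(2) unfolding infinite_nat_iff_unbounded_le by blast
    then show "\<exists>n\<ge>N. n \<in> g (i div 2) \<inter> {j. d / 2 \<le> \<sigma> i * blinfun_apply (z j) x}"
      using big[of k i] j(1,2)[OF i, of k] i by (intro exI[of _ "j k i"]) auto
  qed
  have "infinite (N \<inter> {j. d / 2 \<le> blinfun_apply (z j) x}) \<and>
    infinite (N \<inter> {j. blinfun_apply (z j) x \<le> - (d / 2)})" if "N \<in> \<N>" for N
  proof -
    have "N \<in> g ` {0..<card \<N>}" using bij_betw_imp_surj_on[OF g] \<open>N \<in> \<N>\<close> by simp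
    then obtain q where q: "q < card \<N>" "N = g q" by auto
    have "d / 2 \<le> - t \<longleftrightarrow> t \<le> - (d / 2)" for t by auto
    then show ?thesis using inf_N[of "2 * q"] inf_N[of "2 * q + 1"] q by (simp add: l_def \<sigma>_def)
  qed
  then show ?thesis using x(1) by blast
qed (rule bexI[of _ 0], auto)

text \<open>
  In the second alternative, functionals of norm at most 1 realize every finite sign pattern on the
  vectors \<open>x i\<close>; such \<open>x i\<close> span a copy of \<open>\<ell>\<^sub>1\<close>.
\<close>

theorem null_or_independent:
  "(\<exists>z :: nat \<Rightarrow> 'a \<Rightarrow>\<^sub>L real. (\<forall>x. (\<lambda>k. blinfun_apply (z k) x) \<longlonglongrightarrow> 0) \<and> (\<forall>k. c \<le> norm (z k))) \<or>
   (\<exists>d>0. \<exists>x :: nat \<Rightarrow> 'a. (\<forall>i. norm (x i) \<le> 1) \<and> (\<forall>m I. \<exists>f :: 'a \<Rightarrow>\<^sub>L real. norm f \<le> 1 \<and>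
      (\<forall>i<m. if i \<in> I then d \<le> blinfun_apply f (x i) else blinfun_apply f (x i) \<le> - d)))"
proof -
  obtain z where z: "stable z" using ex_stable by blast
  then have zb: "z \<in> block_sequences" by (simp add: stable_def)
  note z_le = block_sequences_norm_le[OF zb]
  define d where "d = asymptotic_norm z"
  have "d \<ge> 0" unfolding d_def by (rule asymptotic_norm_nonneg[OF z_le])
  then consider "d = 0" | "d > 0" by linarith
  then show ?thesis
  proof cases
    case 1
    then show ?thesis
      using asymptotic_norm_zero[of z, OF z_le] block_sequences_norm_ge[OF zb]
      by (intro disjI1 exI[of _ z]) (simp add: d_def)
  next
    case 2
    let ?A = "\<lambda>x. {j. d / 2 \<le> blinfun_apply (z j) x}"
    let ?B = "\<lambda>x. {j. blinfun_apply (z j) x \<le> - (d / 2)}"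
    have "\<exists>x. (\<forall>k::nat. x k \<in> cball 0 1) \<and>
        (\<forall>m I. (\<Inter>i<m. if i \<in> I then ?A (x i) else ?B (x i)) \<noteq> {})"
    proof (rule independent_sequence[of "\<lambda>\<S>. finite \<S> \<and> (\<forall>S\<in>\<S>. infinite S)"])
      fix \<S> :: "nat set set" assume "finite \<S> \<and> (\<forall>S\<in>\<S>. infinite S)"
      then show "\<exists>p\<in>cball 0 1. finite (\<Union>S\<in>\<S>. {S \<inter> ?A p, S \<inter> ?B p}) \<and>
          (\<forall>S\<in>\<Union>S\<in>\<S>. {S \<inter> ?A p, S \<inter> ?B p}. infinite S)"
        using ex_splitting_vector[OF z d_def 2, of \<S>] by fastforce
    qed auto
    then obtain x where x: "\<forall>k::nat. x k \<in> cball 0 1"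
      "\<forall>m I. (\<Inter>i<m. if i \<in> I then ?A (x i) else ?B (x i)) \<noteq> {}"
      by (elim exE conjE)
    have "\<exists>f. norm f \<le> 1 \<and> (\<forall>i<m. if i \<in> I then d / 2 \<le> blinfun_apply f (x i)
        else blinfun_apply f (x i) \<le> - (d / 2))" for m I
    proof -
      obtain j where j: "j \<in> (\<Inter>i<m. if i \<in> I then ?A (x i) else ?B (x i))"
        using x(2)[THEN spec, THEN spec, of I m] unfolding ex_in_conv[symmetric] by (elim exE)
      have "if i \<in> I then d / 2 \<le> blinfun_apply (z j) (x i) else blinfun_apply (z j) (x i) \<le> - (d / 2)"
        if "i < m" for i
        using INT_D[OF j, of i] that by (cases "i \<in> I") simp_all
      then show ?thesis using z_le by blast
    qed
    then show ?thesis using 2 x(1) by (intro disjI2 exI[of _ "d / 2"] conjI exI[of _ x]) simp_all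
  qed
qed

end

section \<open>Rademacher averages\<close>

text \<open>
  The \<open>n\<close>-th coordinate of a sign pattern, where patterns of length \<open>m\<close> are represented by the subsets
  of \<open>{..<m}\<close>.
\<close>

definition rademacher :: "nat \<Rightarrow> nat set \<Rightarrow> real" where
  "rademacher n S = (if n \<in> S then 1 else - 1)"

lemma rademacher_orthogonal:
  assumes "n < m" "n \<noteq> k"
  shows "(\<Sum>S\<in>Pow {..<m}. rademacher n S * rademacher k S) = 0"
proof -
  let ?h = "\<lambda>S. if n \<in> S then S - {n} else insert n S"
  have "(\<Sum>S\<in>Pow {..<m}. rademacher n S * rademacher k S) =
      (\<Sum>S\<in>Pow {..<m}. - (rademacher n S * rademacher k S))"
    by (rule sum.reindex_bij_witness[of _ ?h ?h])
      (use assms in \<open>auto simp: rademacher_def split: if_splits\<close>)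
  then show ?thesis by (simp add: sum_negf)
qed

text \<open>
  Bessel's inequality for the orthonormal Rademacher functions in \<open>L\<^sub>2\<close> of the uniform distribution
  on the \<open>2 ^ m\<close> sign patterns of length \<open>m\<close>.
\<close>

lemma rademacher_bessel:
  assumes B: "\<And>S. S \<subseteq> {..<m} \<Longrightarrow> \<bar>f S\<bar> \<le> B"
  shows "(\<Sum>n<m. ((\<Sum>S\<in>Pow {..<m}. rademacher n S * f S) / 2 ^ m)\<^sup>2) \<le> B\<^sup>2"
proof -
  let ?P = "Pow {..<m}"
  define c where "c n = (\<Sum>S\<in>?P. rademacher n S * f S) / 2 ^ m" for n
  have c: "(\<Sum>S\<in>?P. rademacher n S * f S) = 2 ^ m * c n" for n by (simp add: c_def)
  have card: "card ?P = 2 ^ m" by (simp add: card_Pow)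
  have rr: "(\<Sum>S\<in>?P. rademacher n S * rademacher k S) = (if n = k then 2 ^ m else 0)"
    if "n < m" for n k
  proof (cases "n = k")
    case True
    have "(\<Sum>S\<in>?P. rademacher k S * rademacher k S) = (\<Sum>S\<in>?P. 1)"
      by (intro sum.cong) (auto simp: rademacher_def)
    then show ?thesis using True card by simp
  qed (use rademacher_orthogonal[OF that] in simp)
  have cross: "(\<Sum>S\<in>?P. f S * (\<Sum>n<m. c n * rademacher n S)) = 2 ^ m * (\<Sum>n<m. (c n)\<^sup>2)"
  proof -
    have "(\<Sum>S\<in>?P. f S * (\<Sum>n<m. c n * rademacher n S)) =
        (\<Sum>S\<in>?P. \<Sum>n<m. c n * (rademacher n S * f S))"
      by (simp add: sum_distrib_left algebra_simps)
    also have "\<dots> = (\<Sum>n<m. c n * (\<Sum>S\<in>?P. rademacher n S * f S))"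
      by (subst sum.swap) (simp add: sum_distrib_left)
    also have "\<dots> = (\<Sum>n<m. c n * (2 ^ m * c n))" by (simp only: c)
    finally show ?thesis by (simp add: sum_distrib_left power2_eq_square algebra_simps)
  qed
  have square: "(\<Sum>S\<in>?P. (\<Sum>n<m. c n * rademacher n S)\<^sup>2) = 2 ^ m * (\<Sum>n<m. (c n)\<^sup>2)"
  proof -
    have "(\<Sum>S\<in>?P. (\<Sum>n<m. c n * rademacher n S)\<^sup>2) =
        (\<Sum>S\<in>?P. \<Sum>n<m. \<Sum>k<m. c n * c k * (rademacher n S * rademacher k S))"
      by (simp add: power2_eq_square sum_product algebra_simps)
    also have "\<dots> = (\<Sum>n<m. \<Sum>k<m. c n * c k * (\<Sum>S\<in>?P. rademacher n S * rademacher k S))"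
      by (subst sum.swap, rule sum.cong[OF refl], subst sum.swap) (simp add: sum_distrib_left)
    also have "\<dots> = (\<Sum>n<m. \<Sum>k<m. if n = k then c n * c k * 2 ^ m else 0)"
      by (intro sum.cong) (auto simp: rr)
    also have "\<dots> = (\<Sum>n<m. c n * c n * 2 ^ m)"
      by (intro sum.cong) (auto simp: sum.delta)
    finally show ?thesis by (simp add: sum_distrib_left power2_eq_square algebra_simps)
  qed
  have "0 \<le> (\<Sum>S\<in>?P. (f S - (\<Sum>n<m. c n * rademacher n S))\<^sup>2)"
    by (intro sum_nonneg) simp
  also have "\<dots> = (\<Sum>S\<in>?P. (f S)\<^sup>2) - 2 * (\<Sum>S\<in>?P. f S * (\<Sum>n<m. c n * rademacher n S)) +
      (\<Sum>S\<in>?P. (\<Sum>n<m. c n * rademacher n S)\<^sup>2)"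
    by (simp add: power2_diff sum.distrib sum_subtractf sum_distrib_left mult.assoc)
  also have "\<dots> = (\<Sum>S\<in>?P. (f S)\<^sup>2) - 2 ^ m * (\<Sum>n<m. (c n)\<^sup>2)"
    by (simp add: cross square)
  finally have "2 ^ m * (\<Sum>n<m. (c n)\<^sup>2) \<le> (\<Sum>S\<in>?P. (f S)\<^sup>2)" by simp
  also have "\<dots> \<le> (\<Sum>S\<in>?P. B\<^sup>2)"
    using B by (intro sum_mono) (auto simp: abs_le_square_iff[symmetric] intro: order_trans[OF _ abs_ge_self])
  also have "\<dots> = 2 ^ m * B\<^sup>2" using card by simp
  finally have "(\<Sum>n<m. (c n)\<^sup>2) \<le> B\<^sup>2" by simp
  then show ?thesis by (simp add: c_def)
qed

section \<open>Weak-star cluster points\<close>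

text \<open>
  The values of all \<open>\<psi> m n\<close> form, for each \<open>m\<close>, one point of a product of compact intervals, indexed by
  pairs of an \<open>n\<close> and a vector. A cluster point of these is the limit along a filter finer than
  \<open>sequentially\<close>, and linearity passes to limits. In contrast to subsequences, such a filter exists
  also for nonseparable spaces.
\<close>

lemma ex_weak_star_cluster_point:
  fixes \<psi> :: "nat \<Rightarrow> nat \<Rightarrow> 'a::real_normed_vector \<Rightarrow>\<^sub>L real"
  assumes le: "\<And>m n. norm (\<psi> m n) \<le> 1"
  shows "\<exists>G :: nat \<Rightarrow> 'a \<Rightarrow>\<^sub>L real. \<exists>H. H \<noteq> bot \<and> H \<le> sequentially \<and>
    (\<forall>n v. ((\<lambda>m. blinfun_apply (\<psi> m n) v) \<longlongrightarrow> blinfun_apply (G n) v) H)"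
proof -
  define F where "F m = (\<lambda>(n, v). blinfun_apply (\<psi> m n) v)" for m
  define K where "K = PiE UNIV (\<lambda>p :: nat \<times> 'a. cball (0 :: real) (norm (snd p)))"
  have le_norm: "\<bar>blinfun_apply (\<psi> m n) v\<bar> \<le> norm v" for m n v
    using norm_blinfun[of "\<psi> m n" v] mult_right_mono[OF le[of m n], of "norm v"] by simp
  have "compactin (product_topology (\<lambda>_. euclidean) UNIV) K"
    unfolding K_def compactin_PiE by simp
  then have "compact K" by (simp add: euclidean_product_topology)
  moreover have "F m \<in> K" for m
    using le_norm by (auto simp: K_def F_def split: prod.split)
  then have "eventually (\<lambda>g. g \<in> K) (filtermap F sequentially)"
    by (simp add: eventually_filtermap)
  moreover have "filtermap F sequentially \<noteq> bot" by (simp add: filtermap_bot_iff)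
  ultimately obtain g where g: "inf (nhds g) (filtermap F sequentially) \<noteq> bot"
    unfolding compact_filter by blast
  define H where "H = inf sequentially (filtercomap F (nhds g))"
  have "H \<noteq> bot"
  proof
    assume "H = bot"
    then have "eventually (\<lambda>_. False) H" by simp
    then obtain P Q where PQ: "eventually P sequentially" "eventually Q (nhds g)"
      "\<And>m. P m \<Longrightarrow> \<not> Q (F m)"
      unfolding H_def eventually_inf eventually_filtercomap by blast
    have "eventually (\<lambda>h. \<exists>m. P m \<and> h = F m) (filtermap F sequentially)"
      unfolding eventually_filtermap using PQ(1) by (rule eventually_mono) blast
    with PQ(2) have "eventually (\<lambda>_. False) (inf (nhds g) (filtermap F sequentially))"
      unfolding eventually_inf using PQ(3) by blast
    then show False using g by (simp add: trivial_limit_def)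
  qed
  have H_seq: "H \<le> sequentially" by (simp add: H_def)
  have "filterlim F (nhds g) (filtercomap F (nhds g))" by (rule filterlim_filtercomap)
  then have "(F \<longlongrightarrow> g) H" by (rule filterlim_mono) (simp_all add: H_def)
  then have "((\<lambda>m. F m (n, v)) \<longlongrightarrow> g (n, v)) H" for n v
    by (rule continuous_on_tendsto_compose[OF continuous_on_product_coordinates[of "(n, v)"]]) auto
  then have lim: "((\<lambda>m. blinfun_apply (\<psi> m n) v) \<longlongrightarrow> g (n, v)) H" for n v by (simp add: F_def)
  have bl: "bounded_linear (\<lambda>v. g (n, v))" for n
  proof (rule bounded_linear_intro[where K = 1])
    fix u v
    have "((\<lambda>m. blinfun_apply (\<psi> m n) u + blinfun_apply (\<psi> m n) v) \<longlongrightarrow> g (n, u) + g (n, v)) H"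
      by (intro tendsto_add lim)
    then show "g (n, u + v) = g (n, u) + g (n, v)"
      using tendsto_unique[OF \<open>H \<noteq> bot\<close> lim[of n "u + v"]] by (simp add: blinfun.add_right)
  next
    fix t :: real and v
    have "((\<lambda>m. t *\<^sub>R blinfun_apply (\<psi> m n) v) \<longlongrightarrow> t *\<^sub>R g (n, v)) H"
      by (intro tendsto_scaleR tendsto_const lim)
    then show "g (n, t *\<^sub>R v) = t *\<^sub>R g (n, v)"
      using tendsto_unique[OF \<open>H \<noteq> bot\<close> lim[of n "t *\<^sub>R v"]] by (simp add: blinfun.scaleR_right)
  next
    fix v
    show "norm (g (n, v)) \<le> norm v * 1"
      using le_norm by (intro tendsto_upperbound[OF tendsto_norm[OF lim] _ \<open>H \<noteq> bot\<close>]) simp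
  qed
  have "\<forall>n v. ((\<lambda>m. blinfun_apply (\<psi> m n) v) \<longlongrightarrow> blinfun_apply (Blinfun (\<lambda>v. g (n, v))) v) H"
    using lim by (simp add: bounded_linear_Blinfun_apply[OF bl])
  then show ?thesis using \<open>H \<noteq> bot\<close> H_seq by (intro exI[of _ "\<lambda>n. Blinfun (\<lambda>v. g (n, v))"]) blast
qed

text \<open>
  For fixed \<open>m\<close>, let \<open>\<psi> m n\<close> be the average over all sign patterns of the \<open>n\<close>-th sign times the
  functional realizing the pattern. Then \<open>\<psi> m n (x n) \<ge> d\<close> for \<open>n < m\<close>, since every summand has this
  bound, and the squares of \<open>\<psi> m n v\<close> for \<open>n < m\<close> sum up to at most \<open>(norm v)\<^sup>2\<close>. Both bounds are
  independent of \<open>m\<close> and so hold in the limit.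
\<close>

lemma independent_imp_weak_star_null:
  fixes x :: "nat \<Rightarrow> 'a::real_normed_vector"
  assumes x: "\<And>i. norm (x i) \<le> 1" and "d > 0"
    and indep: "\<And>m I. \<exists>f :: 'a \<Rightarrow>\<^sub>L real. norm f \<le> 1 \<and>
      (\<forall>i<m. if i \<in> I then d \<le> blinfun_apply f (x i) else blinfun_apply f (x i) \<le> - d)"
  shows "\<exists>z :: nat \<Rightarrow> 'a \<Rightarrow>\<^sub>L real. (\<forall>v. (\<lambda>n. blinfun_apply (z n) v) \<longlonglongrightarrow> 0) \<and> (\<forall>n. d \<le> norm (z n))"
proof -
  obtain \<phi> :: "nat \<Rightarrow> nat set \<Rightarrow> 'a \<Rightarrow>\<^sub>L real" where \<phi>: "\<And>m I. norm (\<phi> m I) \<le> 1"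
    "\<And>m I i. i < m \<Longrightarrow> if i \<in> I then d \<le> blinfun_apply (\<phi> m I) (x i) else blinfun_apply (\<phi> m I) (x i) \<le> - d"
    using indep by metis
  define \<psi> where "\<psi> m n = (1 / 2 ^ m) *\<^sub>R (\<Sum>S\<in>Pow {..<m}. rademacher n S *\<^sub>R \<phi> m S)" for m n
  have \<psi>_apply: "blinfun_apply (\<psi> m n) v = (\<Sum>S\<in>Pow {..<m}. rademacher n S * blinfun_apply (\<phi> m S) v) / 2 ^ m"
    for m n v by (simp add: \<psi>_def blinfun.scaleR_left blinfun.sum_left)
  have card: "real (card (Pow {..<m})) = 2 ^ m" for m :: nat by (simp add: card_Pow)
  have "norm (\<psi> m n) \<le> 1" for m n
  proof -
    have "norm (\<Sum>S\<in>Pow {..<m}. rademacher n S *\<^sub>R \<phi> m S) \<le> of_nat (card (Pow {..<m})) * 1"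
      using \<phi>(1) by (intro sum_norm_bound) (simp add: rademacher_def)
    then show ?thesis by (simp add: \<psi>_def card field_simps)
  qed
  then obtain G :: "nat \<Rightarrow> 'a \<Rightarrow>\<^sub>L real" and H where H: "H \<noteq> bot" "H \<le> sequentially"
    and G: "\<And>n v. ((\<lambda>m. blinfun_apply (\<psi> m n) v) \<longlongrightarrow> blinfun_apply (G n) v) H"
    using ex_weak_star_cluster_point[of \<psi>] by blast
  have ev: "eventually (\<lambda>m. k \<le> m) H" for k
    using H(2) eventually_ge_at_top[of k] by (auto simp: le_filter_def)
  have bessel: "(\<Sum>n<k. (blinfun_apply (G n) v)\<^sup>2) \<le> (norm v)\<^sup>2" for k v
  proof (rule tendsto_upperbound[OF _ _ H(1)])
    show "((\<lambda>m. \<Sum>n<k. (blinfun_apply (\<psi> m n) v)\<^sup>2) \<longlongrightarrow> (\<Sum>n<k. (blinfun_apply (G n) v)\<^sup>2)) H"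
      by (intro tendsto_sum tendsto_power G)
    show "eventually (\<lambda>m. (\<Sum>n<k. (blinfun_apply (\<psi> m n) v)\<^sup>2) \<le> (norm v)\<^sup>2) H"
      using ev[of k]
    proof (rule eventually_mono)
      fix m assume "k \<le> m"
      have "\<bar>blinfun_apply (\<phi> m S) v\<bar> \<le> norm v" for S
        using norm_blinfun[of "\<phi> m S" v] mult_right_mono[OF \<phi>(1)[of m S], of "norm v"] by simp
      then have "(\<Sum>n<m. (blinfun_apply (\<psi> m n) v)\<^sup>2) \<le> (norm v)\<^sup>2"
        unfolding \<psi>_apply by (intro rademacher_bessel) 
      moreover have "(\<Sum>n<k. (blinfun_apply (\<psi> m n) v)\<^sup>2) \<le> (\<Sum>n<m. (blinfun_apply (\<psi> m n) v)\<^sup>2)"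
        using \<open>k \<le> m\<close> by (intro sum_mono2) auto
      ultimately show "(\<Sum>n<k. (blinfun_apply (\<psi> m n) v)\<^sup>2) \<le> (norm v)\<^sup>2" by simp
    qed
  qed
  have null: "(\<lambda>n. blinfun_apply (G n) v) \<longlonglongrightarrow> 0" for v
  proof -
    have "summable (\<lambda>n. (blinfun_apply (G n) v)\<^sup>2)"
      using bessel[of v] by (intro summableI_nonneg_bounded) auto
    then have "(\<lambda>n. (blinfun_apply (G n) v)\<^sup>2) \<longlonglongrightarrow> 0" by (rule summable_LIMSEQ_zero)
    from tendsto_real_sqrt[OF this] show ?thesis by (simp add: tendsto_rabs_zero_iff)
  qed
  have "d \<le> norm (G n)" for n
  proof -
    have "d \<le> blinfun_apply (\<psi> m n) (x n)" if "Suc n \<le> m" for m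
    proof -
      have "(\<Sum>S\<in>Pow {..<m}. d) \<le> (\<Sum>S\<in>Pow {..<m}. rademacher n S * blinfun_apply (\<phi> m S) (x n))"
      proof (rule sum_mono)
        fix S
        show "d \<le> rademacher n S * blinfun_apply (\<phi> m S) (x n)"
          using \<phi>(2)[of n m S] that by (cases "n \<in> S") (auto simp: rademacher_def)
      qed
      then show ?thesis unfolding \<psi>_apply by (simp add: card field_simps)
    qed
    then have "d \<le> blinfun_apply (G n) (x n)"
      by (intro tendsto_lowerbound[OF G _ H(1)] eventually_mono[OF ev[of "Suc n"]])
    also have "\<dots> \<le> norm (G n) * norm (x n)" using norm_blinfun[of "G n" "x n"] by simp
    also have "\<dots> \<le> norm (G n)" using mult_left_mono[OF x[of n], of "norm (G n)"] by simp
    finally show ?thesis .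
  qed
  with null show ?thesis by blast
qed

section \<open>The Josefson--Nissenzweig theorem\<close>

text \<open>
  Separated functionals have a pointwise convergent subsequence or an \<open>\<ell>\<^sub>1\<close>-subsequence; in the
  first case take differences of consecutive terms, in the second case pass to stable blocks.
\<close>

theorem josefson_nissenzweig_real:
  assumes "infinite_dimensional scaleR (UNIV :: 'a::real_normed_vector set)"
  shows "\<exists>z :: nat \<Rightarrow> 'a \<Rightarrow>\<^sub>L real. (\<forall>v. (\<lambda>n. blinfun_apply (z n) v) \<longlonglongrightarrow> 0) \<and> (\<exists>d>0. \<forall>n. d \<le> norm (z n))"
proof -
  obtain y :: "nat \<Rightarrow> 'a \<Rightarrow>\<^sub>L real"
    where y: "\<And>n. norm (y n) \<le> 1" "\<And>m n. m \<noteq> n \<Longrightarrow> 1 \<le> norm (y m - y n)"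
    using ex_separated_functionals[OF assms] by blast
  show ?thesis
  proof (cases "\<exists>r :: nat \<Rightarrow> nat. strict_mono r \<and> (\<forall>v. convergent (\<lambda>n. blinfun_apply (y (r n)) v))")
    case True
    then obtain r :: "nat \<Rightarrow> nat" where r: "strict_mono r" "\<And>v. convergent (\<lambda>n. blinfun_apply (y (r n)) v)"
      by blast
    define z where "z n = y (r (Suc n)) - y (r n)" for n
    have "(\<lambda>n. blinfun_apply (z n) v) \<longlonglongrightarrow> 0" for v
    proof -
      obtain l where "(\<lambda>n. blinfun_apply (y (r n)) v) \<longlonglongrightarrow> l" using r(2)[of v] by (auto simp: convergent_def)
      from tendsto_diff[OF LIMSEQ_Suc[OF this] this] show ?thesis by (simp add: z_def blinfun.diff_left)
    qed
    moreover have "1 \<le> norm (z n)" for n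
      unfolding z_def using r(1) by (intro y(2)) (simp add: strict_mono_eq)
    ultimately show ?thesis by (intro exI[of _ z] conjI exI[of _ 1]) auto
  next
    case False
    then have noconv: "\<exists>x. \<not> convergent (\<lambda>n. blinfun_apply (y (r n)) x)"
      if "strict_mono r" for r :: "nat \<Rightarrow> nat" using that by blast
    have "\<exists>c>0. \<exists>r :: nat \<Rightarrow> nat. \<forall>F a. finite F \<longrightarrow>
        c * (\<Sum>i\<in>F. \<bar>a i\<bar>) \<le> norm (\<Sum>i\<in>F. a i *\<^sub>R y (r i))"
      by (rule rosenthal_ell1[OF y(1) noconv])
    then obtain c and r :: "nat \<Rightarrow> nat" where c: "c > 0"
      "\<forall>F a. finite F \<longrightarrow> c * (\<Sum>i\<in>F. \<bar>a i\<bar>) \<le> norm (\<Sum>i\<in>F. a i *\<^sub>R y (r i))"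
      by (elim exE conjE)
    interpret ell1_functionals "\<lambda>i. y (r i)" c
      by unfold_locales (use y(1) c in auto)
    show ?thesis
      using null_or_independent
    proof
      assume "\<exists>z :: nat \<Rightarrow> 'a \<Rightarrow>\<^sub>L real. (\<forall>x. (\<lambda>k. blinfun_apply (z k) x) \<longlonglongrightarrow> 0) \<and> (\<forall>k. c \<le> norm (z k))"
      then show ?thesis using c(1) by blast
    next
      assume "\<exists>d>0. \<exists>x :: nat \<Rightarrow> 'a. (\<forall>i. norm (x i) \<le> 1) \<and> (\<forall>m I. \<exists>f :: 'a \<Rightarrow>\<^sub>L real. norm f \<le> 1 \<and>
        (\<forall>i<m. if i \<in> I then d \<le> blinfun_apply f (x i) else blinfun_apply f (x i) \<le> - d))"
      then obtain d and x :: "nat \<Rightarrow> 'a" where d: "d > 0" "\<forall>i. norm (x i) \<le> 1"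
        "\<forall>m I. \<exists>f :: 'a \<Rightarrow>\<^sub>L real. norm f \<le> 1 \<and>
          (\<forall>i<m. if i \<in> I then d \<le> blinfun_apply f (x i) else blinfun_apply f (x i) \<le> - d)"
        by (elim exE conjE)
      show ?thesis
        using independent_imp_weak_star_null[of x d, OF spec[OF d(2)] d(1) d(3)[rule_format]] d(1) by blast
    qed
  qed
qed

section \<open>Uniform boundedness\<close>

text \<open>
  By Baire's theorem one of the closed sets where all \<open>f n\<close> are bounded by a fixed \<open>j\<close> contains a
  ball.
\<close>

theorem uniform_boundedness:
  fixes f :: "nat \<Rightarrow> 'a::banach \<Rightarrow>\<^sub>L 'k::real_normed_vector"
  assumes pointwise: "\<And>v. bounded (range (\<lambda>n. blinfun_apply (f n) v))"
  shows "bounded (range f)"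
proof -
  define C where "C j = {v. \<forall>n. norm (blinfun_apply (f n) v) \<le> real j}" for j :: nat
  have "closed (C j)" for j
  proof -
    have "C j = (\<Inter>n. {v. norm (blinfun_apply (f n) v) \<le> real j})" by (auto simp: C_def)
    then show ?thesis by (auto intro!: closed_INT closed_Collect_le continuous_intros)
  qed
  moreover have "\<Union> (range C) = UNIV"
  proof -
    have "\<exists>j. v \<in> C j" for v
    proof -
      obtain b where "\<And>n. norm (blinfun_apply (f n) v) \<le> b"
        using pointwise[of v] by (auto simp: bounded_iff)
      then show ?thesis using real_arch_simple[of b] unfolding C_def by (blast intro: order_trans)
    qed
    then show ?thesis by auto
  qed
  moreover have "Met_TC.mcomplete TYPE('a)" by (simp add: complete_UNIV)
  ultimately obtain j where j: "interior (C j) \<noteq> {}"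
    using Met_TC.metric_Baire_category_alt[of "range C"] by auto
  then obtain x e where e: "e > 0" "ball x e \<subseteq> C j"
    by (meson ex_in_conv mem_interior)
  have "norm (f n) \<le> 4 * real j / e" for n
  proof (rule norm_blinfun_bound)
    show "0 \<le> 4 * real j / e" using e(1) by simp
  next
    fix u
    show "norm (blinfun_apply (f n) u) \<le> 4 * real j / e * norm u"
    proof (cases "u = 0")
      case False
      define t where "t = e / (2 * norm u)"
      have t: "t > 0" using e(1) False by (simp add: t_def)
      have "x + t *\<^sub>R u \<in> C j" "x \<in> C j"
        using e False by (auto simp: subset_iff dist_norm t_def)
      then have "norm (blinfun_apply (f n) (x + t *\<^sub>R u)) \<le> j" "norm (blinfun_apply (f n) x) \<le> j"
        by (auto simp: C_def)
      then have "norm (blinfun_apply (f n) (x + t *\<^sub>R u) - blinfun_apply (f n) x) \<le> 2 * real j"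
        using norm_triangle_ineq4[of "blinfun_apply (f n) (x + t *\<^sub>R u)" "blinfun_apply (f n) x"] by simp
      then have "t * norm (blinfun_apply (f n) u) \<le> 2 * real j"
        using t by (simp add: blinfun.add_right blinfun.scaleR_right)
      then show ?thesis using e(1) False by (simp add: t_def field_simps)
    qed simp
  qed
  then show ?thesis by (auto simp: bounded_iff)
qed

section \<open>Complex scalars\<close>

lemma infinite_dimensional_scaleR:
  fixes smul :: "'k::real_normed_field \<Rightarrow> 'a::real_normed_vector \<Rightarrow> 'a"
  assumes "normed_space_over smul" "infinite_dimensional smul (UNIV :: 'a set)"
  shows "infinite_dimensional scaleR (UNIV :: 'a set)"
  unfolding infinite_dimensional_def
proof (rule notI, elim exE conjE)
  interpret normed_space_over smul by fact
  fix S :: "'a set" assume S: "finite S" "module.span scaleR S = UNIV"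
  have "x \<in> module.span smul S" for x
  proof -
    have "x \<in> Real_Vector_Spaces.span S" using S(2) by (simp add: span_raw_def)
    then show ?thesis
    proof (induction rule: real_vector.span_induct_alt)
      case base show ?case by (rule span_zero)
    next
      case (step c x y)
      have "smul (of_real c) x \<in> module.span smul S" by (intro span_scale span_base step)
      then show ?case using step by (simp add: scale_of_real span_add)
    qed
  qed
  then show False using assms(2) S(1) by (auto simp: infinite_dimensional_def)
qed

text \<open>
  The real part of the complex functional is \<open>f\<close>, whence the inequality of the norms.
\<close>

lemma complexification:
  fixes scaleC :: "complex \<Rightarrow> 'b::real_normed_vector \<Rightarrow> 'b" and f :: "'b \<Rightarrow>\<^sub>L real"
  assumes "normed_space_over scaleC"
  obtains g :: "'b \<Rightarrow>\<^sub>L complex" where "g \<in> dual_space scaleC" "norm f \<le> norm g"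
    "\<And>v. blinfun_apply g v = Complex (blinfun_apply f v) (- blinfun_apply f (scaleC \<i> v))"
proof -
  interpret normed_space_over scaleC by fact
  define h where "h v = Complex (blinfun_apply f v) (- blinfun_apply f (scaleC \<i> v))" for v
  have real: "scaleC (complex_of_real r) v = r *\<^sub>R v" for r v by (rule scale_of_real)
  have ir: "scaleC \<i> (r *\<^sub>R v) = r *\<^sub>R scaleC \<i> v" for r v
    by (simp add: real[symmetric] mult.commute)
  have split: "scaleC c v = Re c *\<^sub>R v + Im c *\<^sub>R scaleC \<i> v" for c v
  proof -
    have "scaleC c v = scaleC (complex_of_real (Re c) + complex_of_real (Im c) * \<i>) v"
      by (simp add: complex_eq mult.commute)
    also have "\<dots> = Re c *\<^sub>R v + Im c *\<^sub>R scaleC \<i> v"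
      by (simp only: scale_left_distrib real scale_scale[symmetric])
    finally show ?thesis .
  qed
  have ii: "scaleC \<i> (scaleC \<i> v) = - v" for v by simp
  have "bounded_linear h"
  proof (rule bounded_linear_intro[where K = "2 * norm f"])
    show "h (u + v) = h u + h v" for u v
      by (simp add: h_def blinfun.add_right scale_right_distrib complex_eq_iff)
    show "h (r *\<^sub>R v) = r *\<^sub>R h v" for r v
      by (simp add: h_def blinfun.scaleR_right ir complex_eq_iff)
    show "norm (h v) \<le> norm v * (2 * norm f)" for v
      using cmod_le[of "h v"] norm_blinfun[of f v] norm_blinfun[of f "scaleC \<i> v"]
      by (simp add: h_def norm_scale mult.commute)
  qed
  then have g: "blinfun_apply (Blinfun h) = h" by (rule bounded_linear_Blinfun_apply)
  have "h (scaleC c v) = c * h v" for c v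
  proof -
    have "scaleC \<i> (scaleC c v) = Re c *\<^sub>R scaleC \<i> v - Im c *\<^sub>R v"
      by (subst split[of c]) (simp only: scale_right_distrib ir ii scaleR_minus_right diff_conv_add_uminus)
    then show ?thesis
      unfolding h_def by (simp add: split[of c v] blinfun.add_right blinfun.diff_right
          blinfun.scaleR_right complex_eq_iff)
  qed
  then have "Blinfun h \<in> dual_space scaleC" by (simp add: dual_space_def g)
  moreover have "norm f \<le> norm (Blinfun h)"
  proof (rule norm_blinfun_bound)
    fix v
    have "norm (blinfun_apply f v) \<le> norm (h v)" using abs_Re_le_cmod[of "h v"] by (simp add: h_def)
    also have "\<dots> \<le> norm (Blinfun h) * norm v" using norm_blinfun[of "Blinfun h" v] by (simp add: g)
    finally show "norm (blinfun_apply f v) \<le> norm (Blinfun h) * norm v" .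
  qed simp
  ultimately show ?thesis using that g by (simp add: h_def)
qed

lemma not_null_if_norm_ge:
  assumes "d > 0" "\<And>n. d \<le> norm (z n)" shows "\<not> z \<longlonglongrightarrow> 0"
proof
  assume "z \<longlonglongrightarrow> 0"
  then have "d \<le> 0"
    using assms(2) LIMSEQ_le_const[OF tendsto_norm_zero, of z d] by auto
  then show False using assms(1) by simp
qed

section \<open>Spaces of weak-star null sequences\<close>

lemma sum_fun_apply: "(\<Sum>v\<in>T. g v) n = (\<Sum>v\<in>T. g v n)"
  for g :: "'c \<Rightarrow> 'd \<Rightarrow> 'e::comm_monoid_add"
  by (induction T rule: infinite_finite_induct) auto

lemma weak_star_null_in_linf:
  fixes smul :: "'k::{real_normed_field,banach} \<Rightarrow> 'a::banach \<Rightarrow> 'a"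
  assumes "weak_star_null smul x"
  shows "x \<in> linf (dual_space smul)"
proof -
  have "bounded (range (\<lambda>n. blinfun_apply (x n) v))" for v
    using assms by (auto simp: weak_star_null_iff intro: convergent_imp_bounded)
  then have "bounded (range x)" by (rule uniform_boundedness)
  then show ?thesis using assms by (simp add: linf_def weak_star_null_def)
qed

text \<open>
  The sequences \<open>multiple a\<close> multiply \<open>x\<close> by a scalar that is constant on each fibre of a map
  \<open>nat \<Rightarrow> nat\<close> with infinite fibres. Those that are bounded form the subspace \<open>W\<close>; they are exactly
  those with bounded \<open>a\<close>.
\<close>

locale fibred_multiples =
  fixes smul :: "'k::{real_normed_field,banach} \<Rightarrow> 'a::real_normed_vector \<Rightarrow> 'a"
    and x :: "nat \<Rightarrow> 'a \<Rightarrow>\<^sub>L 'k"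
  assumes seminormalized: "seminormalized x" and null: "weak_star_null smul x"
begin

abbreviation "X \<equiv> linf (dual_space smul)"

definition fibre :: "nat \<Rightarrow> nat" where "fibre n = fst (prod_decode n)"

definition multiple :: "(nat \<Rightarrow> 'k) \<Rightarrow> nat \<Rightarrow> 'a \<Rightarrow>\<^sub>L 'k" where
  "multiple a n = dual_scale (a (fibre n)) (x n)"

definition W :: "(nat \<Rightarrow> 'a \<Rightarrow>\<^sub>L 'k) set" where "W = range multiple \<inter> X"

definition \<delta> :: real where "\<delta> = (INF j. norm (x j))"

lemma fibre_encode: "fibre (prod_encode (k, j)) = k"
  by (simp add: fibre_def)

lemma \<delta>_pos: "\<delta> > 0" and \<delta>_le: "\<delta> \<le> norm (x n)"
proof -
  show "\<delta> > 0" using seminormalized by (simp add: seminormalized_def \<delta>_def)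
  have "bdd_below (range (\<lambda>j. norm (x j)))" by (auto intro!: bdd_belowI[of _ 0])
  then show "\<delta> \<le> norm (x n)" unfolding \<delta>_def by (rule cINF_lower) simp
qed

lemma x_nonzero: "x n \<noteq> 0"
  using \<delta>_pos \<delta>_le[of n] by auto

lemma multiple_apply: "blinfun_apply (multiple a n) v = a (fibre n) * blinfun_apply (x n) v"
  by (simp add: multiple_def)

lemma norm_multiple: "norm (multiple a n) = norm (a (fibre n)) * norm (x n)"
  by (simp add: multiple_def norm_dual_scale)

lemma multiple_in_X:
  assumes "\<And>k. norm (a k) \<le> b" shows "multiple a \<in> X"
proof -
  obtain c where c: "\<And>n. norm (x n) \<le> c"
    using seminormalized unfolding seminormalized_def bdd_above_def by blast
  have "norm (multiple a n) \<le> b * c" for n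
    unfolding norm_multiple using assms c by (intro mult_mono) (auto intro: order_trans[OF norm_ge_zero])
  moreover have "multiple a n \<in> dual_space smul" for n
    using null by (auto simp: weak_star_null_def dual_space_def multiple_apply)
  ultimately show ?thesis by (auto simp: linf_def bounded_iff)
qed

lemma coefficient_bound:
  assumes "multiple a \<in> X" shows "\<exists>b. \<forall>k. norm (a k) \<le> b"
proof -
  obtain b where b: "\<And>n. norm (multiple a n) \<le> b" using assms by (auto simp: linf_def bounded_iff)
  have "norm (a k) \<le> b / \<delta>" for k
  proof -
    have "norm (a k) * \<delta> \<le> norm (multiple a (prod_encode (k, 0)))"
      by (simp add: norm_multiple fibre_encode mult_left_mono \<delta>_le)
    then show ?thesis using b[of "prod_encode (k, 0)"] \<delta>_pos by (simp add: field_simps)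
  qed
  then show ?thesis by blast
qed

lemma x_in_W: "x \<in> W"
proof -
  have "multiple (\<lambda>_. 1) = x" by (intro ext blinfun_eqI) (simp add: multiple_apply)
  moreover have "multiple (\<lambda>_. 1) \<in> X" by (rule multiple_in_X[of _ 1]) simp
  ultimately show ?thesis unfolding W_def by (metis IntI rangeI)
qed

lemma multiple_weak_star_null:
  assumes "multiple a \<in> X" shows "weak_star_null smul (multiple a)"
proof -
  obtain b where b: "\<And>k. norm (a k) \<le> b" using coefficient_bound[OF assms] by blast
  have "(\<lambda>n. blinfun_apply (multiple a n) v) \<longlonglongrightarrow> 0" for v
  proof (rule Lim_null_comparison)
    have "(\<lambda>n. blinfun_apply (x n) v) \<longlonglongrightarrow> 0" using null by (simp add: weak_star_null_iff)
    then show "(\<lambda>n. b * norm (blinfun_apply (x n) v)) \<longlonglongrightarrow> 0"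
      by (intro tendsto_mult_right_zero tendsto_norm_zero)
    show "eventually (\<lambda>n. norm (blinfun_apply (multiple a n) v) \<le> b * norm (blinfun_apply (x n) v)) sequentially"
      using b by (intro always_eventually) (simp add: multiple_apply norm_mult mult_right_mono)
  qed
  then show ?thesis using assms by (simp add: weak_star_null_iff linf_def)
qed

text \<open>
  A nonzero multiplier \<open>a k\<close> occurs at infinitely many places, where the norm is at least
  \<open>norm (a k) * \<delta>\<close>.
\<close>

lemma multiple_not_null:
  assumes "multiple a \<noteq> 0" shows "\<not> multiple a \<longlonglongrightarrow> 0"
proof
  assume lim: "multiple a \<longlonglongrightarrow> 0"
  have "\<exists>k. a k \<noteq> 0"
  proof (rule ccontr)
    assume "\<not> ?thesis"
    then have "multiple a = 0" by (intro ext blinfun_eqI) (simp add: multiple_apply)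
    then show False using assms by simp
  qed
  then obtain k where k: "a k \<noteq> 0" by blast
  have "strict_mono (\<lambda>j. prod_encode (k, j))"
    by (simp add: strict_mono_Suc_iff prod_encode_def)
  then have "(\<lambda>j. multiple a (prod_encode (k, j))) \<longlonglongrightarrow> 0"
    using LIMSEQ_subseq_LIMSEQ[OF lim] by (simp add: o_def)
  moreover have "norm (a k) * \<delta> \<le> norm (multiple a (prod_encode (k, j)))" for j
    by (simp add: norm_multiple fibre_encode mult_left_mono \<delta>_le)
  ultimately show False
    using not_null_if_norm_ge[of "norm (a k) * \<delta>" "\<lambda>j. multiple a (prod_encode (k, j))"] k \<delta>_pos by simp
qed

lemma W_subset: "W - {0} \<subseteq> weak_star_null_non_norm_null smul"
  using multiple_weak_star_null multiple_not_null
  by (auto simp: W_def weak_star_null_non_norm_null_def)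

sublocale banach: banach_sequence_space dual_scale X sup_norm
  by (rule banach_sequence_space_linf_dual)

sublocale seq: vector_space "seq_scale (dual_scale :: 'k \<Rightarrow> ('a \<Rightarrow>\<^sub>L 'k) \<Rightarrow> _)"
  by (rule vector_space_seq_scale) unfold_locales

lemma subspace_W: "seq.subspace W"
proof (rule seq.subspaceI)
  have "multiple (\<lambda>_. 0) = 0" by (intro ext blinfun_eqI) (simp add: multiple_apply)
  then show "0 \<in> W" unfolding W_def using seq.subspace_0[OF banach.subspace_X] by (auto intro: range_eqI[OF sym])
next
  fix u v assume "u \<in> W" "v \<in> W"
  then obtain a b where ab: "u = multiple a" "v = multiple b" "u \<in> X" "v \<in> X" by (auto simp: W_def)
  have "u + v = multiple (\<lambda>k. a k + b k)"
    unfolding ab(1,2) by (intro ext blinfun_eqI) (simp add: multiple_apply blinfun.add_left distrib_right)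
  then show "u + v \<in> W"
    unfolding W_def using seq.subspace_add[OF banach.subspace_X ab(3,4)] by blast
next
  fix c u assume "u \<in> W"
  then obtain a where a: "u = multiple a" "u \<in> X" by (auto simp: W_def)
  have "seq_scale dual_scale c u = multiple (\<lambda>k. c * a k)"
    unfolding a(1) by (intro ext blinfun_eqI) (simp add: multiple_apply seq_scale_def)
  then show "seq_scale dual_scale c u \<in> W"
    unfolding W_def using seq.subspace_scale[OF banach.subspace_X a(2)] by blast
qed

text \<open>
  Convergence in the sup norm implies convergence of every term. Evaluating a term of
  the fibre \<open>k\<close> at a vector where \<open>x\<close> does not vanish there shows that the multipliers converge as
  well.
\<close>

lemma closed_W: "closedin (Metric_space.mtopology X (norm_dist X sup_norm)) W"
proof -
  interpret M: Metric_space X "norm_dist X sup_norm" by (rule banach.Metric_space_norm_dist)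
  have "l \<in> W" if \<sigma>: "range \<sigma> \<subseteq> W" and lim: "limitin M.mtopology \<sigma> l sequentially" for \<sigma> l
  proof -
    have lX: "l \<in> X" and dist: "(\<lambda>j. norm_dist X sup_norm (\<sigma> j) l) \<longlonglongrightarrow> 0"
      using lim by (simp_all add: M.limitin_metric_dist_null)
    have \<sigma>X: "\<sigma> j \<in> X" for j using \<sigma> by (auto simp: W_def)
    have "\<exists>a. \<sigma> j = multiple a" for j using \<sigma> unfolding W_def by blast
    then obtain a where a: "\<And>j. \<sigma> j = multiple (a j)" by metis
    have coord: "(\<lambda>j. \<sigma> j n) \<longlonglongrightarrow> l n" for n
    proof -
      have "norm (\<sigma> j n - l n) \<le> norm_dist X sup_norm (\<sigma> j) l" for j
      proof -
        have "\<sigma> j - l \<in> X" by (rule seq.subspace_diff[OF banach.subspace_X \<sigma>X lX])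
        then have "norm ((\<sigma> j - l) n) \<le> sup_norm (\<sigma> j - l)"
          by (intro sup_norm_ge) (simp add: linf_def)
        then show ?thesis using \<sigma>X lX by (simp add: norm_dist_def)
      qed
      then have "(\<lambda>j. \<sigma> j n - l n) \<longlonglongrightarrow> 0"
        by (intro Lim_null_comparison[OF _ dist] always_eventually) simp
      then show ?thesis by (simp add: LIM_zero_iff)
    qed
    then have coord_apply: "(\<lambda>j. a j (fibre n) * blinfun_apply (x n) v) \<longlonglongrightarrow> blinfun_apply (l n) v" for n v
      using blinfun.tendsto[OF coord[of n] tendsto_const[of v]] unfolding a multiple_apply by simp
    have "\<exists>b. (\<lambda>j. a j k) \<longlonglongrightarrow> b" for k
    proof -
      let ?n = "prod_encode (k, 0)"
      obtain v where v: "blinfun_apply (x ?n) v \<noteq> 0"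
        using x_nonzero[of ?n] by (metis blinfun_eqI zero_blinfun.rep_eq)
      have "(\<lambda>j. a j k * blinfun_apply (x ?n) v / blinfun_apply (x ?n) v)
          \<longlonglongrightarrow> blinfun_apply (l ?n) v / blinfun_apply (x ?n) v"
        using coord_apply[of ?n v] v by (intro tendsto_divide) (simp_all add: fibre_encode)
      then show ?thesis using v by auto
    qed
    then obtain b where b: "\<And>k. (\<lambda>j. a j k) \<longlonglongrightarrow> b k" by metis
    have "l n = multiple b n" for n
    proof (rule blinfun_eqI)
      fix v
      have "(\<lambda>j. a j (fibre n) * blinfun_apply (x n) v) \<longlonglongrightarrow> b (fibre n) * blinfun_apply (x n) v"
        by (intro tendsto_mult b tendsto_const)
      then show "blinfun_apply (l n) v = blinfun_apply (multiple b n) v"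
        unfolding multiple_apply by (rule LIMSEQ_unique[OF coord_apply])
    qed
    then have "l = multiple b" by (rule ext)
    then show "l \<in> W" using lX by (auto simp: W_def)
  qed
  moreover have "W \<subseteq> X" by (auto simp: W_def)
  ultimately show ?thesis by (auto simp: M.metric_closedin_iff_sequentially_closed)
qed

text \<open>
  The restrictions of \<open>x\<close> to the single fibres are nonzero and have disjoint supports.
\<close>

lemma infinite_dimensional_W: "infinite_dimensional (seq_scale dual_scale) W"
proof -
  define e where "e k = multiple (\<lambda>i. if i = k then 1 else 0)" for k
  have e_W: "e k \<in> W" for k
    using multiple_in_X[of "\<lambda>i. if i = k then 1 else 0" 1] by (auto simp: e_def W_def)
  have e_apply: "e k n = (if fibre n = k then x n else 0)" for k n
    by (rule blinfun_eqI) (simp add: e_def multiple_apply)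
  have inj: "inj e"
  proof (rule injI)
    fix k k' assume "e k = e k'"
    then have "e k (prod_encode (k, 0)) = e k' (prod_encode (k, 0))" by simp
    then show "k = k'" using x_nonzero by (simp add: e_apply fibre_encode split: if_splits)
  qed
  have "\<not> seq.dependent (range e)"
    unfolding seq.dependent_explicit
  proof (rule notI, elim exE conjE bexE)
    fix T u v
    assume T: "finite T" "T \<subseteq> range e" "(\<Sum>v\<in>T. seq_scale dual_scale (u v) v) = 0" "v \<in> T" "u v \<noteq> 0"
    obtain k where k: "v = e k" using T by auto
    let ?n = "prod_encode (k, 0)"
    have "0 = (\<Sum>w\<in>T. seq_scale dual_scale (u w) w ?n)"
      using fun_cong[OF T(3), of ?n] by (simp add: sum_fun_apply)
    also have "\<dots> = seq_scale dual_scale (u v) v ?n + (\<Sum>w\<in>T - {v}. seq_scale dual_scale (u w) w ?n)"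
      using T(1,4) by (rule sum.remove)
    finally have "0 = seq_scale dual_scale (u v) v ?n + (\<Sum>w\<in>T - {v}. seq_scale dual_scale (u w) w ?n)" .
    moreover have "(\<Sum>w\<in>T - {v}. seq_scale dual_scale (u w) w ?n) = 0"
    proof (rule sum.neutral, rule ballI)
      fix w assume "w \<in> T - {v}"
      then obtain k' where "w = e k'" "k' \<noteq> k" using T(2) k by auto
      then show "seq_scale dual_scale (u w) w ?n = 0"
        by (intro blinfun_eqI) (simp add: seq_scale_def e_apply fibre_encode)
    qed
    moreover have "v ?n = x ?n" by (simp add: k e_apply fibre_encode)
    ultimately have "dual_scale (u v) (x ?n) = 0" by (simp add: seq_scale_def)
    then have "norm (u v) * norm (x ?n) = 0" using norm_dual_scale[of "u v" "x ?n"] by simp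
    then show False using T(5) x_nonzero by simp
  qed
  moreover have "infinite (range e)" using inj by (simp add: finite_image_iff)
  ultimately have "seq.span S \<noteq> W" if "finite S" for S
    using seq.independent_span_bound[OF that, of "range e"] e_W by blast
  then show ?thesis by (auto simp: infinite_dimensional_def)
qed

theorem closed_infinite_dimensional_subspace_W:
  "closed_infinite_dimensional_subspace dual_scale X sup_norm W"
  unfolding closed_infinite_dimensional_subspace_def
  using subspace_W closed_W infinite_dimensional_W by (auto simp: W_def)

end

lemma seminormalized_subsequence:
  fixes x :: "nat \<Rightarrow> 'f::real_normed_vector"
  assumes "bounded (range x)" "\<not> x \<longlonglongrightarrow> 0"
  obtains r :: "nat \<Rightarrow> nat" where "strict_mono r" "seminormalized (x \<circ> r)"
proof -
  obtain e where e: "e > 0" "\<And>N. \<exists>n\<ge>N. e \<le> norm (x n)"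
    using assms(2) unfolding LIMSEQ_iff by (force simp: not_less)
  then have inf: "infinite {n. e \<le> norm (x n)}" by (auto simp: infinite_nat_iff_unbounded_le)
  define r where "r = enumerate {n. e \<le> norm (x n)}"
  have r: "strict_mono r" "\<And>i. e \<le> norm (x (r i))"
    using strict_mono_enumerate[OF inf] enumerate_in_set[OF inf] by (auto simp: r_def)
  have "e \<le> (INF j. norm ((x \<circ> r) j))" using r(2) by (intro cINF_greatest) auto
  moreover obtain b where "\<And>n. norm (x n) \<le> b" using assms(1) by (auto simp: bounded_iff)
  then have "bdd_above (range (\<lambda>j. norm ((x \<circ> r) j)))" by (intro bdd_aboveI2[of _ _ b]) simp
  ultimately have "seminormalized (x \<circ> r)" using e(1) by (simp add: seminormalized_def)
  with r(1) show ?thesis by (rule that)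
qed

theorem spaceability:
  fixes smul :: "'k::{real_normed_field,banach} \<Rightarrow> 'a::banach \<Rightarrow> 'a"
  defines "B \<equiv> weak_star_null_non_norm_null smul" and "X \<equiv> linf (dual_space smul)"
  assumes "B \<noteq> {}"
  shows "almost_pointwise_spaceable dual_scale X sup_norm B"
    and "seminormalized x \<Longrightarrow> weak_star_null smul x \<Longrightarrow>
      \<exists>W. closed_infinite_dimensional_subspace dual_scale X sup_norm W \<and> W - {0} \<subseteq> B \<and> x \<in> W"
proof -
  show W: "\<exists>W. closed_infinite_dimensional_subspace dual_scale X sup_norm W \<and> W - {0} \<subseteq> B \<and> x \<in> W"
    if x: "seminormalized x" "weak_star_null smul x" for x
  proof -
    interpret fibred_multiples smul x by unfold_locales (fact x)+
    show ?thesis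
      unfolding B_def X_def
      using closed_infinite_dimensional_subspace_W W_subset x_in_W by blast
  qed
  have BX: "B \<subseteq> X"
    using weak_star_null_in_linf unfolding B_def X_def weak_star_null_non_norm_null_def by blast
  have "\<exists>W. closed_infinite_dimensional_subspace dual_scale X sup_norm W \<and> W \<subseteq> B \<union> {0}
      \<and> (\<exists>r::nat \<Rightarrow> nat. strict_mono r \<and> x \<circ> r \<in> W)" if x: "x \<in> B" for x
  proof -
    have null: "weak_star_null smul x" and "\<not> x \<longlonglongrightarrow> 0" "bounded (range x)"
      using x BX by (auto simp: B_def X_def weak_star_null_non_norm_null_def linf_def)
    then obtain r :: "nat \<Rightarrow> nat" where r: "strict_mono r" "seminormalized (x \<circ> r)"
      using seminormalized_subsequence by blast
    have "weak_star_null smul (x \<circ> r)"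
      using null LIMSEQ_subseq_LIMSEQ[OF _ r(1)] by (fastforce simp: weak_star_null_iff o_def)
    then show ?thesis using W[OF r(2)] r(1) by blast
  qed
  then show "almost_pointwise_spaceable dual_scale X sup_norm B"
    unfolding almost_pointwise_spaceable_def
    using banach_sequence_space_linf_dual[of smul] assms(3) BX by (simp add: X_def)
qed

section \<open>Weak-star null sequences that are not norm null\<close>

theorem weak_star_null_non_norm_null_real:
  assumes "infinite_dimensional scaleR (UNIV :: 'a::real_normed_vector set)"
  shows "weak_star_null_non_norm_null (scaleR :: real \<Rightarrow> 'a \<Rightarrow> 'a) \<noteq> {}"
proof -
  obtain z :: "nat \<Rightarrow> 'a \<Rightarrow>\<^sub>L real" and d where
    z: "\<And>v. (\<lambda>n. blinfun_apply (z n) v) \<longlonglongrightarrow> 0" "d > 0" "\<And>n. d \<le> norm (z n)"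
    using josefson_nissenzweig_real[OF assms] by blast
  then have "z \<in> weak_star_null_non_norm_null scaleR"
    using not_null_if_norm_ge[of d z]
    by (simp add: weak_star_null_non_norm_null_def weak_star_null_iff dual_space_scaleR)
  then show ?thesis by blast
qed

theorem weak_star_null_non_norm_null_complex:
  fixes scaleC :: "complex \<Rightarrow> 'b::real_normed_vector \<Rightarrow> 'b"
  assumes "normed_space_over scaleC" "infinite_dimensional scaleC (UNIV :: 'b set)"
  shows "weak_star_null_non_norm_null scaleC \<noteq> {}"
proof -
  obtain z :: "nat \<Rightarrow> 'b \<Rightarrow>\<^sub>L real" and d where
    z: "\<And>v. (\<lambda>n. blinfun_apply (z n) v) \<longlonglongrightarrow> 0" "d > 0" "\<And>n. d \<le> norm (z n)"
    using josefson_nissenzweig_real[OF infinite_dimensional_scaleR[OF assms]] by blast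
  have "\<exists>g. g \<in> dual_space scaleC \<and> norm (z n) \<le> norm g \<and>
      (\<forall>v. blinfun_apply g v = Complex (blinfun_apply (z n) v) (- blinfun_apply (z n) (scaleC \<i> v)))" for n
    using complexification[OF assms(1), of "z n"] by blast
  then obtain g where g: "\<And>n. g n \<in> dual_space scaleC" "\<And>n. norm (z n) \<le> norm (g n)"
    "\<And>n v. blinfun_apply (g n) v = Complex (blinfun_apply (z n) v) (- blinfun_apply (z n) (scaleC \<i> v))"
    by metis
  have "(\<lambda>n. blinfun_apply (g n) v) \<longlonglongrightarrow> 0" for v
    using tendsto_Complex[OF z(1)[of v] tendsto_minus[OF z(1)[of "scaleC \<i> v"]]]
    by (simp add: g(3) zero_complex.code)
  moreover have "\<not> g \<longlonglongrightarrow> 0"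
    using z(2,3) g(2) by (intro not_null_if_norm_ge[of d]) (auto intro: order_trans)
  ultimately have "g \<in> weak_star_null_non_norm_null scaleC"
    using g(1) by (auto simp: weak_star_null_non_norm_null_def weak_star_null_iff)
  then show ?thesis by blast
qed

theorem corollary3p5:
  fixes scaleC :: "complex \<Rightarrow> 'b::banach \<Rightarrow> 'b"
  shows
    "(infinite_dimensional scaleR (UNIV :: 'a::banach set) \<longrightarrow>
        (let smul = (scaleR :: real \<Rightarrow> 'a \<Rightarrow> 'a);
             X = linf (dual_space smul);
             B = weak_star_null_non_norm_null smul
         in almost_pointwise_spaceable dual_scale X sup_norm B
          \<and> (\<forall>x. seminormalized x \<and> weak_star_null smul x \<longrightarrow>
               (\<exists>W. closed_infinite_dimensional_subspace dual_scale X sup_norm W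
                  \<and> W - {0} \<subseteq> B \<and> x \<in> W))))
     \<and>
     (normed_space_over scaleC \<and> infinite_dimensional scaleC (UNIV :: 'b set) \<longrightarrow>
        (let X = linf (dual_space scaleC);
             B = weak_star_null_non_norm_null scaleC
         in almost_pointwise_spaceable dual_scale X sup_norm B
          \<and> (\<forall>x. seminormalized x \<and> weak_star_null scaleC x \<longrightarrow>
               (\<exists>W. closed_infinite_dimensional_subspace dual_scale X sup_norm W
                  \<and> W - {0} \<subseteq> B \<and> x \<in> W))))"
  unfolding Let_def
proof (intro conjI impI allI; (elim conjE)?)
  assume "infinite_dimensional scaleR (UNIV :: 'a set)"
  note nonempty = weak_star_null_non_norm_null_real[OF this]
  show "almost_pointwise_spaceable dual_scale (linf (dual_space (scaleR :: real \<Rightarrow> 'a \<Rightarrow> 'a))) sup_norm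
      (weak_star_null_non_norm_null (scaleR :: real \<Rightarrow> 'a \<Rightarrow> 'a))"
    by (rule spaceability(1)[OF nonempty])
  show "\<exists>W. closed_infinite_dimensional_subspace dual_scale
        (linf (dual_space (scaleR :: real \<Rightarrow> 'a \<Rightarrow> 'a))) sup_norm W
      \<and> W - {0} \<subseteq> weak_star_null_non_norm_null scaleR \<and> x \<in> W"
    if "seminormalized x" "weak_star_null (scaleR :: real \<Rightarrow> 'a \<Rightarrow> 'a) x" for x
    using that by (rule spaceability(2)[OF nonempty])
next
  assume "normed_space_over scaleC" "infinite_dimensional scaleC (UNIV :: 'b set)"
  note nonempty = weak_star_null_non_norm_null_complex[OF this]
  show "almost_pointwise_spaceable dual_scale (linf (dual_space scaleC)) sup_norm
      (weak_star_null_non_norm_null scaleC)"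
    by (rule spaceability(1)[OF nonempty])
  show "\<exists>W. closed_infinite_dimensional_subspace dual_scale (linf (dual_space scaleC)) sup_norm W
      \<and> W - {0} \<subseteq> weak_star_null_non_norm_null scaleC \<and> x \<in> W"
    if "seminormalized x" "weak_star_null scaleC x" for x
    using that by (rule spaceability(2)[OF nonempty])
qed

end
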